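(* There exist positive constants $a$ and $b$ such that, for every positive integer $n$, the number of isomorphism classes of $3$-valent $5$-arc-transitive graphs of order at most $n$ is at least $n^{a\log n}-b$.
   Context: All graphs are finite, connected, simple. The order of a graph is its number of vertices. An $s$-arc in a graph is a sequence of $s+1$ vertices such that every two consecutive vertices are adjacent and every three consecutive vertices are pairwise distinct. A graph $\Gamma$ is $s$-arc-transitive if $\mathrm{Aut}(\Gamma)$ acts transitively on the $s$-arcs of $\Gamma$. $\log$ is the natural logarithm. *)

theory Defs
  imports Complex_Main "Graph_Theory.Graph_Theory"
begin

text \<open>
  A finite simple graph is a \<^locale>\<open>pair_graph\<close>: a finite vertex set together with a symmetric,
  irreflexive set of ordered pairs of vertices. An undirected edge is represented by
  two opposite pairs.
\<close>

definition automorphism ::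
    "('a, 'b) pre_digraph \<Rightarrow> ('a, 'b, 'a, 'b) digraph_isomorphism \<Rightarrow> bool" where
  "automorphism G f \<longleftrightarrow> pre_digraph.digraph_isomorphism G f \<and> app_iso f G = G"

definition s_arc :: "('a, 'b) pre_digraph \<Rightarrow> nat \<Rightarrow> 'a list \<Rightarrow> bool" where
  "s_arc G s p \<longleftrightarrow> length p = s + 1 \<and> vwalk p G \<and>
    (\<forall>i. i + 2 < length p \<longrightarrow> distinct [p ! i, p ! (i + 1), p ! (i + 2)])"

definition s_arc_transitive :: "nat \<Rightarrow> ('a, 'b) pre_digraph \<Rightarrow> bool" where
  "s_arc_transitive s G \<longleftrightarrow>
    (\<forall>p q. s_arc G s p \<and> s_arc G s q \<longrightarrow> (\<exists>f. automorphism G f \<and> map (iso_verts f) p = q))"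

text \<open>In a symmetric digraph the out-degree of a vertex is its valency.\<close>

definition valent :: "nat \<Rightarrow> ('a, 'b) pre_digraph \<Rightarrow> bool" where
  "valent k G \<longleftrightarrow> (\<forall>v \<in> verts G. out_degree G v = k)"

text \<open>
  Every finite graph is isomorphic to one whose vertices are natural numbers, so it suffices to
  take isomorphism classes of the latter. The qualified name distinguishes connectedness of a graph
  from topological connectedness.
\<close>

definition cubic_5_arc_transitive_graphs :: "nat \<Rightarrow> nat pair_pre_digraph set" where
  "cubic_5_arc_transitive_graphs n =
    {G. pair_graph G \<and> Digraph_Component.connected (with_proj G) \<and> card (pverts G) \<le> n \<and>
        valent 3 (with_proj G) \<and> s_arc_transitive 5 (with_proj G)}"

definition isomorphism_classes :: "'a pair_pre_digraph set \<Rightarrow> 'a pair_pre_digraph set set" where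
  "isomorphism_classes S =
    S // {(G, H). G \<in> S \<and> H \<in> S \<and> digraph_iso (with_proj G) (with_proj H)}"

end

theory Submission
  imports Defs "HOL-Library.Z2" "HOL-Computational_Algebra.Formal_Power_Series"
    "HOL-Combinatorics.Permutations" "HOL-Library.FuncSet" "HOL-Library.Countable_Set"
begin

text \<open>
  The graphs are covers of the Tutte 8-cage \<open>T\<close>, whose automorphism group \<open>A\<close> is transitive on
  5-arcs. Put voltages on \<open>T\<close> in a center-by-metabelian group \<open>E\<close> of matrices over power series with
  coefficients in the field of two elements, and identify two walks \<open>w\<close>, \<open>w'\<close> from the base point
  if they have the same end and, for all \<open>a \<in> A\<close>, the voltages of \<open>a w\<close> and \<open>a w'\<close> agree modulo a
  normal subgroup of \<open>E\<close> that contains the \<open>m\<close>-th congruence subgroup. This relation is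
  \<open>A\<close>-invariant, so \<open>A\<close> lifts and the cover is 5-arc-transitive; its order is at most exponential
  in \<open>m\<close>. The central subgroup of corner entries, modulo the congruence subgroup, is a vector space of dimension \<open>m\<close>, and
  certain closed walks, parametrised by a space of dimension about \<open>m\<close>, have all their voltages there.
  Subspaces of it give \<open>2\<close> to the power of a multiple of \<open>m\<^sup>2\<close> covers, distinguished by which
  of these walks have closed lifts.

  It remains to see that few of these covers are isomorphic. All of them contain a closed
  nonbacktracking walk of the same bounded length, because the second derived group of \<open>E\<close> has exponent
  two. By Tutte's argument an automorphism is then determined by the image of an arc of bounded length,
  so a cover of order \<open>n\<close> has polynomially many automorphisms in \<open>n\<close>. The lifts of three elements of
  \<open>A\<close> already determine which walks have closed lifts, so that each isomorphism class contains only
  polynomially many of the covers.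
\<close>

section \<open>Automorphisms as vertex maps\<close>

text \<open>Arcs of a pair graph are pairs of vertices, so an isomorphism is determined by its
  vertex map; the arc, head and tail components of the isomorphism record add no
  information.\<close>

definition vert_iso :: "'a pair_pre_digraph \<Rightarrow> 'b pair_pre_digraph \<Rightarrow> ('a \<Rightarrow> 'b) \<Rightarrow> bool" where
  "vert_iso G H f \<longleftrightarrow> bij_betw f (pverts G) (pverts H) \<and>
    (\<forall>u \<in> pverts G. \<forall>v \<in> pverts G. (u, v) \<in> parcs G \<longleftrightarrow> (f u, f v) \<in> parcs H)"

lemma vert_iso_id: "vert_iso G G id"
  by (simp add: vert_iso_def)

lemma vert_iso_comp:
  assumes "vert_iso G H f" "vert_iso H K g"
  shows "vert_iso G K (g \<circ> f)"
proof -
  have "f u \<in> pverts H" if "u \<in> pverts G" for u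
    using assms(1) that by (auto simp: vert_iso_def bij_betw_def)
  then show ?thesis
    using assms by (auto simp: vert_iso_def intro: bij_betw_trans)
qed

lemma vert_iso_inv:
  assumes "vert_iso G H f"
  shows "vert_iso H G (inv_into (pverts G) f)"
proof -
  let ?g = "inv_into (pverts G) f"
  have b: "bij_betw f (pverts G) (pverts H)" using assms by (simp add: vert_iso_def)
  have "?g x \<in> pverts G" "f (?g x) = x" if "x \<in> pverts H" for x
    using b that by (auto simp: bij_betw_def f_inv_into_f inv_into_into)
  then show ?thesis
    using assms by (auto simp: vert_iso_def bij_betw_inv_into)
qed

lemma vert_iso_mem: "vert_iso G H f \<Longrightarrow> v \<in> pverts G \<Longrightarrow> f v \<in> pverts H"
  by (auto simp: vert_iso_def bij_betw_def)

lemma vert_iso_inj: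
  "vert_iso G H f \<Longrightarrow> u \<in> pverts G \<Longrightarrow> v \<in> pverts G \<Longrightarrow> f u = f v \<longleftrightarrow> u = v"
  by (auto simp: vert_iso_def bij_betw_def inj_on_eq_iff)

lemma vert_iso_cong:
  assumes "vert_iso G H f" "\<And>v. v \<in> pverts G \<Longrightarrow> f v = g v"
  shows "vert_iso G H g"
  using assms bij_betw_cong[of "pverts G" f g] by (simp add: vert_iso_def)

lemma (in pair_wf_digraph) digraph_isomorphism_of_vert_iso:
  assumes "pair_wf_digraph H" "vert_iso G H f"
  defines "hom \<equiv> \<lparr>iso_verts = f, iso_arcs = map_prod f f, iso_head = snd, iso_tail = fst\<rparr>"
  shows "pre_digraph.digraph_isomorphism (with_proj G) hom"
    and "app_iso hom (with_proj G) = with_proj H"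
proof -
  interpret H: pair_wf_digraph H by fact
  have b: "bij_betw f (pverts G) (pverts H)"
    and e: "\<And>u v. u \<in> pverts G \<Longrightarrow> v \<in> pverts G \<Longrightarrow> (u, v) \<in> parcs G \<longleftrightarrow> (f u, f v) \<in> parcs H"
    using assms(2) by (auto simp: vert_iso_def)
  have inj: "inj_on f (pverts G)" and im: "f ` pverts G = pverts H"
    using b by (auto simp: bij_betw_def)
  have "inj_on (map_prod f f) (pverts G \<times> pverts G)"
    using inj by (simp add: map_prod_inj_on)
  then have injA: "inj_on (map_prod f f) (parcs G)"
    by (rule inj_on_subset) (auto dest: in_arcsD1 in_arcsD2)
  show "digraph_isomorphism hom"
    unfolding digraph_isomorphism_def hom_def
    using inj injA wf_digraph_axioms by auto
  have "map_prod f f ` parcs G = parcs H"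
  proof (intro equalityI subsetI)
    fix x assume "x \<in> parcs H"
    moreover obtain u v where x: "x = (u, v)" by (cases x)
    ultimately have "u \<in> f ` pverts G" "v \<in> f ` pverts G" "(u, v) \<in> parcs H"
      using im by (auto dest: H.in_arcsD1 H.in_arcsD2)
    then obtain u' v' where "u' \<in> pverts G" "v' \<in> pverts G" "u = f u'" "v = f v'" by auto
    moreover then have "(u', v') \<in> parcs G" using e[of u' v'] \<open>(u, v) \<in> parcs H\<close> by simp
    ultimately show "x \<in> map_prod f f ` parcs G" unfolding x by force
  next
    fix x assume "x \<in> map_prod f f ` parcs G"
    then obtain u v where "(u, v) \<in> parcs G" "x = (f u, f v)" by auto
    then show "x \<in> parcs H" using e[of u v] in_arcsD1 in_arcsD2 by blast
  qed
  then show "app_iso hom (with_proj G) = with_proj H"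
    by (simp add: app_iso_def hom_def with_proj_def im)
qed

text \<open>Both graphs have \<open>fst\<close> and \<open>snd\<close> as tail and head, which
  forces the arc component of \<open>f\<close> to act as the vertex component on both ends of an
  arc.\<close>

lemma (in pair_wf_digraph) vert_iso_of_digraph_isomorphism:
  assumes "pre_digraph.digraph_isomorphism (with_proj G) f" "with_proj H = app_iso f (with_proj G)"
  shows "vert_iso G H (iso_verts f)"
proof -
  have v: "pverts H = iso_verts f ` pverts G" and a: "parcs H = iso_arcs f ` parcs G"
    and h: "iso_head f = snd" "iso_tail f = fst"
    using assms(2) by (auto simp: app_iso_def with_proj_def)
  have inj: "inj_on (iso_verts f) (pverts G)"
    and ends: "\<And>u v. (u, v) \<in> parcs G \<Longrightarrow> iso_arcs f (u, v) = (iso_verts f u, iso_verts f v)"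
    using assms(1) h unfolding digraph_isomorphism_def by (auto simp: prod_eq_iff)
  have "(u, v) \<in> parcs G \<longleftrightarrow> (iso_verts f u, iso_verts f v) \<in> parcs H"
    if uv: "u \<in> pverts G" "v \<in> pverts G" for u v
  proof
    assume "(iso_verts f u, iso_verts f v) \<in> parcs H"
    then obtain x y where xy: "(x, y) \<in> parcs G" "(iso_verts f u, iso_verts f v) = iso_arcs f (x, y)"
      unfolding a by auto
    then have "x \<in> pverts G" "y \<in> pverts G" "iso_verts f u = iso_verts f x" "iso_verts f v = iso_verts f y"
      using ends[OF xy(1)] by (auto dest: in_arcsD1 in_arcsD2)
    then show "(u, v) \<in> parcs G" using inj uv xy(1) by (auto dest: inj_onD)
  qed (auto simp: a ends[symmetric])
  then show ?thesis using inj v by (simp add: vert_iso_def bij_betw_def)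
qed

lemma digraph_iso_iff_vert_iso:
  assumes "pair_wf_digraph G" "pair_wf_digraph H"
  shows "digraph_iso (with_proj G) (with_proj H) \<longleftrightarrow> (\<exists>f. vert_iso G H f)"
proof -
  interpret pair_wf_digraph G by fact
  show ?thesis
    using digraph_isomorphism_of_vert_iso[OF assms(2)] vert_iso_of_digraph_isomorphism
    unfolding digraph_iso_def by metis
qed

lemma s_arc_transitive_iff_vert_iso:
  assumes "pair_wf_digraph G"
  shows "s_arc_transitive s (with_proj G) \<longleftrightarrow>
    (\<forall>p q. s_arc (with_proj G) s p \<and> s_arc (with_proj G) s q \<longrightarrow>
      (\<exists>f. vert_iso G G f \<and> map f p = q))" (is "?L \<longleftrightarrow> ?R")
proof -
  interpret pair_wf_digraph G by fact
  show ?thesis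
  proof
    assume ?L then show ?R
      unfolding s_arc_transitive_def automorphism_def
      by (metis vert_iso_of_digraph_isomorphism)
  next
    assume R: ?R
    show ?L unfolding s_arc_transitive_def automorphism_def
    proof (intro allI impI)
      fix p q assume "s_arc (with_proj G) s p \<and> s_arc (with_proj G) s q"
      then obtain f where "vert_iso G G f" "map f p = q" using R by blast
      then show "\<exists>f. (digraph_isomorphism f \<and> app_iso f (with_proj G) = with_proj G) \<and>
          map (iso_verts f) p = q"
        using digraph_isomorphism_of_vert_iso[OF assms]
        by (intro exI[of _ "\<lparr>iso_verts = f, iso_arcs = map_prod f f, iso_head = snd, iso_tail = fst\<rparr>"])
          auto
    qed
  qed
qed

section \<open>Arcs as vertex lists, in index form\<close>

lemma set_vwalk_arcs: "set (vwalk_arcs p) = (\<lambda>i. (p ! i, p ! Suc i)) ` {i. Suc i < length p}"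
proof (induction p rule: vwalk_arcs.induct)
  case (3 x y xs)
  have *: "{i. Suc i < length (x # y # xs)} = insert 0 (Suc ` {i. Suc i < length (y # xs)})"
    by (auto simp: less_Suc_eq_0_disj)
  show ?case
    unfolding * by (simp add: 3 image_image)
qed auto

text \<open>Irreflexivity already separates adjacent entries, so of the three inequalities only the
  one between entries at distance two remains.\<close>

lemma (in pair_graph) s_arc_iff:
  "s_arc (with_proj G) s p \<longleftrightarrow> length p = Suc s \<and> set p \<subseteq> pverts G \<and>
    (\<forall>i < s. (p ! i, p ! Suc i) \<in> parcs G) \<and> (\<forall>i. Suc i < s \<longrightarrow> p ! i \<noteq> p ! Suc (Suc i))"
proof -
  have "distinct [p ! i, p ! Suc i, p ! Suc (Suc i)] \<longleftrightarrow> p ! i \<noteq> p ! Suc (Suc i)"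
    if "\<forall>i < s. (p ! i, p ! Suc i) \<in> parcs G" "Suc i < s" for i
    using that no_loops'[of "p ! i" "p ! Suc i"] no_loops'[of "p ! Suc i" "p ! Suc (Suc i)"] by auto
  moreover have "vwalk p (with_proj G) \<longleftrightarrow> set p \<subseteq> pverts G \<and> (\<forall>i < s. (p ! i, p ! Suc i) \<in> parcs G)"
    if "length p = Suc s"
    using that unfolding vwalk_def set_vwalk_arcs by auto
  ultimately show ?thesis
    unfolding s_arc_def by (auto simp: numeral_2_eq_2)
qed

section \<open>Arc-transitive cubic graphs\<close>

locale cubic_graph = pair_graph G for G :: "'a pair_pre_digraph" +
  assumes conn: "Digraph_Component.connected (with_proj G)"
    and cubic: "valent 3 (with_proj G)"
begin

lemma card_neighbours:
  assumes "v \<in> pverts G"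
  shows "card {w. (v, w) \<in> parcs G} = 3"
proof -
  have "out_arcs (with_proj G) v = Pair v ` {w. (v, w) \<in> parcs G}"
    by (auto simp: out_arcs_def image_iff)
  moreover have "inj_on (Pair v) {w. (v, w) \<in> parcs G}" by (simp add: inj_on_def)
  ultimately show ?thesis
    using cubic assms by (auto simp: valent_def out_degree_def card_image)
qed

lemma neighbours_eq:
  assumes "(v, a) \<in> parcs G" "(v, b) \<in> parcs G" "(v, c) \<in> parcs G" "a \<noteq> b" "a \<noteq> c" "b \<noteq> c"
  shows "{w. (v, w) \<in> parcs G} = {a, b, c}"
proof -
  have "card {w. (v, w) \<in> parcs G} = 3" using assms in_arcsD1 by (blast intro: card_neighbours)
  moreover from this have "finite {w. (v, w) \<in> parcs G}" by (metis card.infinite zero_neq_numeral)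
  ultimately show ?thesis using assms by (intro card_subset_eq[symmetric]) auto
qed

lemma other_neighbour:
  assumes "v \<in> pverts G"
  obtains y where "(v, y) \<in> parcs G" "y \<noteq> x"
proof -
  have "\<not> {w. (v, w) \<in> parcs G} \<subseteq> {x}"
  proof
    assume "{w. (v, w) \<in> parcs G} \<subseteq> {x}"
    then have "card {w. (v, w) \<in> parcs G} \<le> card {x}" by (intro card_mono) auto
    then show False using card_neighbours[OF assms] by simp
  qed
  then show thesis using that by blast
qed

lemma connected_induct:
  assumes "x \<in> pverts G" "P x" "\<And>u v. P u \<Longrightarrow> (u, v) \<in> parcs G \<Longrightarrow> P v" "y \<in> pverts G"
  shows "P y"
proof -
  have "strongly_connected (with_proj G)"
    using symmetric_connected_imp_strongly_connected[OF pair_sym_arcs conn] .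
  then have "x \<rightarrow>\<^sup>*\<^bsub>with_proj G\<^esub> y"
    using assms by (auto simp: strongly_connected_def)
  then show ?thesis
    by (induction rule: reachable_induct) (use assms in auto)
qed

lemma s_arcD:
  assumes "s_arc (with_proj G) k q"
  shows "length q = Suc k"
    and "i \<le> k \<Longrightarrow> q ! i \<in> pverts G"
    and "k > 0 \<Longrightarrow> (q ! (k - 1), q ! k) \<in> parcs G"
    and "Suc i < k \<Longrightarrow> q ! i \<noteq> q ! Suc (Suc i)"
proof -
  have q: "length q = Suc k" "set q \<subseteq> pverts G" "\<And>i. i < k \<Longrightarrow> (q ! i, q ! Suc i) \<in> parcs G"
    "\<And>i. Suc i < k \<Longrightarrow> q ! i \<noteq> q ! Suc (Suc i)"
    using assms by (auto simp: s_arc_iff)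
  show "length q = Suc k" by fact
  show "i \<le> k \<Longrightarrow> q ! i \<in> pverts G" using q(1,2) nth_mem[of i q] by auto
  show "k > 0 \<Longrightarrow> (q ! (k - 1), q ! k) \<in> parcs G" using q(3)[of "k - 1"] by simp
  show "Suc i < k \<Longrightarrow> q ! i \<noteq> q ! Suc (Suc i)" by fact
qed

lemma last_s_arc:
  assumes "s_arc (with_proj G) k q"
  shows "last q = q ! k"
proof -
  have "length q = Suc k" using assms by (simp add: s_arc_iff)
  moreover from this have "q \<noteq> []" by auto
  ultimately show ?thesis by (simp add: last_conv_nth)
qed

lemma s_arc_snoc:
  assumes "s_arc (with_proj G) k q" "(last q, x) \<in> parcs G" "k > 0 \<Longrightarrow> x \<noteq> q ! (k - 1)"
  shows "s_arc (with_proj G) (Suc k) (q @ [x])"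
proof -
  note last_s_arc[OF assms(1)]
  moreover have "x \<in> pverts G" using assms(2) in_arcsD2 by auto
  moreover have "q ! i \<noteq> x" if "Suc i = k" for i using that assms(3) by auto
  ultimately show ?thesis
    using assms(1,2) unfolding s_arc_iff by (auto simp: nth_append less_Suc_eq)
qed

lemma s_arc_tl:
  assumes "s_arc (with_proj G) (Suc k) q"
  shows "s_arc (with_proj G) k (tl q)"
proof -
  have len: "length q = Suc (Suc k)" using assms by (simp add: s_arc_iff)
  then have "tl q ! i = q ! Suc i" if "i \<le> k" for i using that by (simp add: nth_tl)
  moreover have "set (tl q) \<subseteq> pverts G"
    using assms by (cases q) (auto simp: s_arc_iff)
  ultimately show ?thesis using assms len by (simp add: s_arc_iff)
qed

lemma s_arc_take:
  assumes "s_arc (with_proj G) k q" "l \<le> k"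
  shows "s_arc (with_proj G) l (take (Suc l) q)"
  using assms set_take_subset[of "Suc l" q] unfolding s_arc_iff by auto

lemma s_arc_rev:
  assumes "s_arc (with_proj G) k q"
  shows "s_arc (with_proj G) k (rev q)"
proof -
  have q: "length q = Suc k" "\<And>i. i < k \<Longrightarrow> (q ! Suc i, q ! i) \<in> parcs G"
    "\<And>i. Suc i < k \<Longrightarrow> q ! i \<noteq> q ! Suc (Suc i)"
    using assms arcs_symmetric by (auto simp: s_arc_iff)
  have "(rev q ! i, rev q ! Suc i) \<in> parcs G" if "i < k" for i
    using q(2)[of "k - Suc i"] that q(1) by (auto simp: rev_nth Suc_diff_Suc)
  moreover have "rev q ! i \<noteq> rev q ! Suc (Suc i)" if "Suc i < k" for i
  proof -
    have "Suc (Suc (k - Suc (Suc i))) = k - i" "Suc (k - Suc (Suc i)) < k" using that by auto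
    then show ?thesis using q(3)[of "k - Suc (Suc i)"] that q(1) by (auto simp: rev_nth)
  qed
  ultimately show ?thesis using assms by (auto simp: s_arc_iff)
qed

lemma s_arc_extension:
  assumes "s_arc (with_proj G) k q"
  obtains x where "s_arc (with_proj G) (Suc k) (q @ [x])"
proof -
  have "last q \<in> pverts G" using assms by (cases q rule: rev_cases) (auto simp: s_arc_iff)
  then obtain x where "(last q, x) \<in> parcs G" "x \<noteq> q ! (k - 1)"
    by (rule other_neighbour)
  then show thesis using s_arc_snoc[OF assms] that by blast
qed

text \<open>Valency three leaves a continuation for every arc. Two \<open>s\<close>-arcs therefore
  extend by one vertex, and an automorphism matching the extensions matches the originals.\<close>

lemma s_arc_transitive_mono:
  assumes "s_arc_transitive (Suc s) (with_proj G)"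
  shows "s_arc_transitive s (with_proj G)"
  unfolding s_arc_transitive_iff_vert_iso[OF pair_wf_digraph]
proof (intro allI impI)
  fix p q assume pq: "s_arc (with_proj G) s p \<and> s_arc (with_proj G) s q"
  obtain x y where "s_arc (with_proj G) (Suc s) (p @ [x])" "s_arc (with_proj G) (Suc s) (q @ [y])"
    using s_arc_extension pq by metis
  then obtain f where "vert_iso G G f" "map f (p @ [x]) = q @ [y]"
    using assms unfolding s_arc_transitive_iff_vert_iso[OF pair_wf_digraph] by blast
  then show "\<exists>f. vert_iso G G f \<and> map f p = q" by auto
qed

text \<open>The end of \<open>p\<close> has just two continuations that do not backtrack, namely
  \<open>w\<close> and \<open>f w\<close>. After moving \<open>p\<close> to the initial part of any
  longer arc, composing with \<open>f\<close> if necessary also corrects the last vertex.\<close>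

lemma s_arc_transitive_Suc:
  assumes tr: "s_arc_transitive s (with_proj G)" and s: "s > 0"
    and p: "s_arc (with_proj G) s p"
    and f: "vert_iso G G f" "map f p = p"
    and w: "(last p, w) \<in> parcs G" "f w \<noteq> w"
  shows "s_arc_transitive (Suc s) (with_proj G)"
proof -
  have len: "length p = Suc s" using p by (simp add: s_arc_iff)
  note last = last_s_arc[OF p]
  have fp: "f (p ! i) = p ! i" if "i \<le> s" for i
    using arg_cong[OF f(2), of "\<lambda>l. l ! i"] that len by auto
  have ps: "p ! i \<in> pverts G" if "i \<le> s" for i
    using s_arcD(2)[OF p that] .
  have pback: "(p ! s, p ! (s - 1)) \<in> parcs G"
    using arcs_symmetric[OF s_arcD(3)[OF p s]] .
  have wv: "w \<in> pverts G" using w in_arcsD2 by auto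
  have fw: "(p ! s, f w) \<in> parcs G"
    using f(1) w(1) ps[of s] wv fp[of s] unfolding vert_iso_def last by auto
  have "p ! (s - 1) \<noteq> w" using w(2) fp[of "s - 1"] by auto
  moreover have "p ! (s - 1) \<noteq> f w"
    using vert_iso_inj[OF f(1) ps[of "s - 1"] wv] fp[of "s - 1"] calculation by auto
  ultimately have nb: "{x. (p ! s, x) \<in> parcs G} = {p ! (s - 1), w, f w}"
    using pback w fw by (intro neighbours_eq) (auto simp: last)
  \<comment> \<open>It suffices to reach every \<open>P\<close> from the single arc
    \<open>p @ [w]\<close>; any two targets are then linked through it.\<close>
  have ex: "\<exists>g. vert_iso G G g \<and> map g (p @ [w]) = P" if P: "s_arc (with_proj G) (Suc s) P" for P
  proof -
    let ?z = "P ! Suc s"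
    have lenP: "length P = Suc (Suc s)" using P by (simp add: s_arc_iff)
    have "s_arc (with_proj G) s (take (Suc s) P)" using s_arc_take[OF P] by simp
    then obtain g where g: "vert_iso G G g" "map g p = take (Suc s) P"
      using tr p unfolding s_arc_transitive_iff_vert_iso[OF pair_wf_digraph] by blast
    have gp: "g (p ! i) = P ! i" if "i \<le> s" for i
      using arg_cong[OF g(2), of "\<lambda>l. l ! i"] that len by auto
    have "?z \<in> pverts G" using P lenP nth_mem[of "Suc s" P] by (auto simp: s_arc_iff)
    then have "?z \<in> g ` pverts G" using g(1) unfolding vert_iso_def bij_betw_def by blast
    then obtain x where x: "?z = g x" "x \<in> pverts G" by blast
    have "(g (p ! s), g x) \<in> parcs G" using s_arcD(3)[OF P] x gp[of s] by simp
    then have "(p ! s, x) \<in> parcs G" using g(1) x(2) ps[of s] unfolding vert_iso_def by auto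
    moreover have "P ! (s - 1) \<noteq> ?z"
      using s_arcD(4)[OF P, of "s - 1"] s by simp
    then have "x \<noteq> p ! (s - 1)" using gp[of "s - 1"] x(1) by auto
    ultimately have xw: "x = w \<or> x = f w" using nb by auto
    have P_eq: "take (Suc s) P @ [?z] = P"
      using take_Suc_conv_app_nth[of "Suc s" P] lenP by simp
    have "map (g \<circ> f) p = map g (map f p)" by simp
    also have "\<dots> = take (Suc s) P" unfolding f(2) by (rule g(2))
    finally have gf: "map (g \<circ> f) p = take (Suc s) P" .
    from xw show ?thesis
    proof
      assume "x = w"
      then have "map g (p @ [w]) = P" unfolding map_append g(2) using P_eq x(1) by simp
      then show ?thesis using g(1) by blast
    next
      assume "x = f w"
      then have "map (g \<circ> f) (p @ [w]) = P" unfolding map_append gf using P_eq x(1) by simp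
      then show ?thesis using vert_iso_comp[OF f(1) g(1)] by blast
    qed
  qed
  show ?thesis
    unfolding s_arc_transitive_iff_vert_iso[OF pair_wf_digraph]
  proof (intro allI impI, elim conjE)
    fix P Q assume "s_arc (with_proj G) (Suc s) P" "s_arc (with_proj G) (Suc s) Q"
    then obtain g h where gh: "vert_iso G G g" "map g (p @ [w]) = P" "vert_iso G G h" "map h (p @ [w]) = Q"
      using ex by metis
    let ?k = "h \<circ> inv_into (pverts G) g"
    have "inv_into (pverts G) g (g v) = v" if "v \<in> set (p @ [w])" for v
      using gh(1) that wv p by (intro inv_into_f_f) (auto simp: vert_iso_def bij_betw_def s_arc_iff)
    then have "map ?k P = Q" unfolding gh(2,4)[symmetric] map_map by (intro map_cong) auto
    then show "\<exists>f. vert_iso G G f \<and> map f P = Q"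
      using vert_iso_comp[OF vert_iso_inv[OF gh(1)] gh(3)] by blast
  qed
qed

text \<open>Tutte's argument: if the graph is not \<open>(s + 1)\<close>-arc-transitive, an automorphism that fixes an
  \<open>s\<close>-arc also fixes its shunts and its reversal.\<close>

lemma vert_iso_fixing_s_arc:
  assumes tr: "s_arc_transitive s (with_proj G)" "\<not> s_arc_transitive (Suc s) (with_proj G)" and s: "s > 0"
    and p: "s_arc (with_proj G) s p"
    and f: "vert_iso G G f" "map f p = p" and v: "v \<in> pverts G"
  shows "f v = v"
proof -
  \<comment> \<open>An arc is good if it ends an \<open>s\<close>-arc fixed by \<open>f\<close>.
    Goodness will spread over the whole graph.\<close>
  define good where "good = (\<lambda>v w. \<exists>p. s_arc (with_proj G) s p \<and> map f p = p \<and> p ! (s - 1) = v \<and> p ! s = w)"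
  have arc: "(v, w) \<in> parcs G" if "good v w" for v w
    using that s s_arcD(3) unfolding good_def by blast
  \<comment> \<open>A neighbour moved by \<open>f\<close> would give transitivity on
    \<open>(s + 1)\<close>-arcs.\<close>
  have nbr_fixed: "f x = x" if "good v w" "(w, x) \<in> parcs G" for v w x
    using s_arc_transitive_Suc[OF tr(1) s _ f(1), of _ x] tr(2) that
    unfolding good_def by (metis last_s_arc)
  have shunt: "good w x" if vw: "good v w" and x: "(w, x) \<in> parcs G" "x \<noteq> v" for v w x
  proof -
    obtain q where q: "s_arc (with_proj G) s q" "map f q = q" "q ! (s - 1) = v" "q ! s = w"
      using vw unfolding good_def by auto
    then have len: "length q = Suc s" and "last q = w"
      using last_s_arc by (auto simp: s_arc_iff)
    then have "s_arc (with_proj G) s (tl (q @ [x]))"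
      using s_arc_tl[OF s_arc_snoc[OF q(1)]] x q(3) by auto
    moreover have "map f (tl (q @ [x])) = tl (q @ [x])"
      using q(2) nbr_fixed[OF vw x(1)] by (simp add: map_tl)
    moreover have "tl (q @ [x]) ! (s - 1) = w" "tl (q @ [x]) ! s = x"
      using len q(4) s by (auto simp: nth_tl nth_append)
    ultimately show ?thesis unfolding good_def by blast
  qed
  \<comment> \<open>Repeated shunting gives fixed arcs that start, rather than end, with the given
    good arc; reversing one of them makes the opposite arc good.\<close>
  have walk: "\<exists>q. s_arc (with_proj G) (Suc k) q \<and> map f q = q \<and> q ! 0 = v \<and> q ! 1 = w \<and>
      good (q ! k) (q ! Suc k)" if vw: "good v w" for v w k
  proof (induction k)
    case 0
    have "f v = v" using nbr_fixed[OF vw] arc[OF vw] arcs_symmetric by blast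
    moreover have "f w = w"
    proof -
      obtain q where "length q = Suc s" "map f q = q" "q ! s = w"
        using vw unfolding good_def by (auto simp: s_arc_iff)
      then show ?thesis by (metis lessI nth_map)
    qed
    ultimately
    show ?case using vw arc[OF vw] in_arcsD1 in_arcsD2
      by (intro exI[of _ "[v, w]"]) (auto simp: s_arc_iff)
  next
    case (Suc k)
    then obtain q where q: "s_arc (with_proj G) (Suc k) q" "map f q = q" "q ! 0 = v" "q ! 1 = w"
      "good (q ! k) (q ! Suc k)" by blast
    have len: "length q = Suc (Suc k)" using q(1) by (simp add: s_arc_iff)
    have "q ! Suc k \<in> pverts G" using q(1) len nth_mem[of "Suc k" q] by (auto simp: s_arc_iff)
    then obtain x where x: "(q ! Suc k, x) \<in> parcs G" "x \<noteq> q ! k" by (rule other_neighbour)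
    have "s_arc (with_proj G) (Suc (Suc k)) (q @ [x])"
      using s_arc_snoc[OF q(1), of x] x last_s_arc[OF q(1)] by auto
    moreover have "map f (q @ [x]) = q @ [x]" using q(2) nbr_fixed[OF q(5) x(1)] by simp
    ultimately show ?case using q(3,4) shunt[OF q(5) x] len
      by (intro exI[of _ "q @ [x]"]) (auto simp: nth_append)
  qed
  have rev: "good w v" if vw: "good v w" for v w
  proof -
    obtain q where q: "s_arc (with_proj G) s q" "map f q = q" "q ! 0 = v" "q ! 1 = w"
      using walk[OF vw, of "s - 1"] s by auto
    have "length q = Suc s" using q(1) by (simp add: s_arc_iff)
    then have "map f (rev q) = rev q" "rev q ! (s - 1) = w" "rev q ! s = v"
      using q s by (auto simp: rev_nth rev_map[symmetric])
    then show ?thesis unfolding good_def using s_arc_rev[OF q(1)] by blast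
  qed
  have all: "\<forall>x. (w, x) \<in> parcs G \<longrightarrow> good w x" if "good v w" for v w
    using shunt[OF that] rev[OF that] by blast
  have "good (p ! (s - 1)) (p ! s)" using p f(2) unfolding good_def by blast
  then have "\<forall>x. (p ! s, x) \<in> parcs G \<longrightarrow> good (p ! s) x" by (rule all)
  moreover have "p ! s \<in> pverts G" using p nth_mem[of s p] by (auto simp: s_arc_iff)
  ultimately have "\<forall>x. (v, x) \<in> parcs G \<longrightarrow> good v x"
    using connected_induct[of "p ! s" "\<lambda>u. \<forall>x. (u, x) \<in> parcs G \<longrightarrow> good u x" v] all v by blast
  moreover obtain y where y: "(v, y) \<in> parcs G" using v by (rule other_neighbour)
  ultimately have "good v y" by blast
  then show ?thesis using nbr_fixed arcs_symmetric[OF y] by blast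
qed

text \<open>No automorphism maps the closed arc \<open>p\<close> to an \<open>l\<close>-arc with
  distinct ends, so transitivity on arcs first breaks off after some \<open>s < l\<close>. An
  automorphism is then determined by the image of one \<open>s\<close>-arc, hence by the images of
  \<open>s + 1 \<le> l\<close> list entries.\<close>

lemma card_automorphisms_le:
  assumes tr: "s_arc_transitive 1 (with_proj G)"
    and p: "s_arc (with_proj G) l p" "p ! 0 = p ! l" "l > 1"
  shows "finite {f \<in> extensional (pverts G). vert_iso G G f}"
    and "card {f \<in> extensional (pverts G). vert_iso G G f} \<le> card (pverts G) ^ l"
proof -
  have "\<not> s_arc_transitive l (with_proj G)"
  proof
    assume l: "s_arc_transitive l (with_proj G)"
    have len: "length p = Suc l" using p by (simp add: s_arc_iff)
    have P: "p ! i \<in> pverts G" if "i \<le> l" for i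
      using that p nth_mem[of i p] by (auto simp: s_arc_iff)
    \<comment> \<open>One of the three neighbours avoids both the previous vertex and the closing
      vertex; putting it at the end opens the closed arc.\<close>
    obtain x where x: "(p ! (l - 1), x) \<in> parcs G" "x \<noteq> p ! (l - 2)" "x \<noteq> p ! l"
    proof -
      have "\<not> {x. (p ! (l - 1), x) \<in> parcs G} \<subseteq> {p ! (l - 2), p ! l}"
      proof
        assume "{x. (p ! (l - 1), x) \<in> parcs G} \<subseteq> {p ! (l - 2), p ! l}"
        then have "card {x. (p ! (l - 1), x) \<in> parcs G} \<le> card {p ! (l - 2), p ! l}"
          by (intro card_mono) auto
        also have "\<dots> \<le> 2" by (simp add: card_insert_if)
        finally show False using card_neighbours[OF P[of "l - 1"]] by simp
      qed
      then show thesis using that by blast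
    qed
    let ?q = "take l p"
    have q: "s_arc (with_proj G) (l - 1) ?q" using s_arc_take[OF p(1), of "l - 1"] p(3) by simp
    moreover have "last ?q = p ! (l - 1)" using last_s_arc[OF q] p(3) by simp
    ultimately have "s_arc (with_proj G) l (?q @ [x])"
      using s_arc_snoc[of "l - 1" ?q x] x p(3) by (auto simp: numeral_2_eq_2)
    then obtain f where f: "vert_iso G G f" "map f p = ?q @ [x]"
      using l p(1) unfolding s_arc_transitive_iff_vert_iso[OF pair_wf_digraph] by blast
    have "map f p ! 0 = p ! 0" "map f p ! l = x"
      unfolding f(2) using len p(3) by (auto simp: nth_append)
    then have "f (p ! 0) = p ! 0" "f (p ! l) = x" using len by auto
    then show False using p(2) x(3) by auto
  qed
  \<comment> \<open>\<open>l'\<close> is the last level before transitivity first fails;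
    \<open>tr\<close> makes it positive, and the failure at \<open>l\<close> makes it less than
    \<open>l\<close>.\<close>
  moreover define l' where "l' = (LEAST k. \<not> s_arc_transitive (Suc k) (with_proj G))"
  ultimately have "\<not> s_arc_transitive (Suc l') (with_proj G)" "l' \<le> l - 1"
    using p(3) LeastI[of "\<lambda>k. \<not> s_arc_transitive (Suc k) (with_proj G)" "l - 1"]
      Least_le[of "\<lambda>k. \<not> s_arc_transitive (Suc k) (with_proj G)" "l - 1"] by auto
  moreover from this have "l' \<noteq> 0" using tr by (metis One_nat_def)
  moreover from this have "s_arc_transitive l' (with_proj G)"
    using not_less_Least[of "l' - 1" "\<lambda>k. \<not> s_arc_transitive (Suc k) (with_proj G)"]
    unfolding l'_def[symmetric] by simp
  ultimately obtain s where s: "1 \<le> s" "s < l" "s_arc_transitive s (with_proj G)" "\<not> s_arc_transitive (Suc s) (with_proj G)"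
    using p(3) by (intro that[of l']) auto
  let ?A = "{f \<in> extensional (pverts G). vert_iso G G f}"
  let ?q = "take (Suc s) p"
  have q: "s_arc (with_proj G) s ?q" using s_arc_take[OF p(1), of s] s(2) by simp
  have "inj_on (\<lambda>f. map f ?q) ?A"
  proof
    fix f g assume fg: "f \<in> ?A" "g \<in> ?A" "map f ?q = map g ?q"
    let ?h = "inv_into (pverts G) g \<circ> f"
    have g: "vert_iso G G g" "inj_on g (pverts G)" "g ` pverts G = pverts G"
      using fg by (auto simp: vert_iso_def bij_betw_def)
    have h: "vert_iso G G ?h" using fg vert_iso_comp vert_iso_inv by blast
    have "map ?h ?q = map (inv_into (pverts G) g) (map g ?q)" unfolding fg(3)[symmetric] by simp
    also have "\<dots> = ?q"
      using q g(2) by (auto simp: s_arc_iff subset_iff intro!: map_idI inv_into_f_f)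
    finally have "?h v = v" if "v \<in> pverts G" for v
      using vert_iso_fixing_s_arc[OF s(3,4) _ q h _ that] s(1) by simp
    then have "f v = g v" if "v \<in> pverts G" for v
      using that g(3) fg(1) vert_iso_mem[of G G f v] f_inv_into_f[of "f v" g "pverts G"] by auto
    then show "f = g" using fg by (auto intro: extensionalityI)
  qed
  moreover have sub: "(\<lambda>f. map f ?q) ` ?A \<subseteq> {xs. set xs \<subseteq> pverts G \<and> length xs = Suc s}" (is "_ \<subseteq> ?L")
  proof -
    have "set ?q \<subseteq> pverts G" "length ?q = Suc s" using q by (simp_all only: s_arc_iff)
    moreover have "set (map f ?q) \<subseteq> pverts G" if "vert_iso G G f" for f
      using vert_iso_mem[OF that] calculation(1) unfolding set_map by blast
    ultimately show ?thesis unfolding image_subset_iff mem_Collect_eq length_map by blast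
  qed
  moreover have fin: "finite ?L" using finite_lists_length_eq[OF pair_finite_verts] .
  ultimately show "finite ?A" using inj_on_finite[of _ ?A ?L] by blast
  have "card ?A = card ((\<lambda>f. map f ?q) ` ?A)"
    using \<open>inj_on _ _\<close> by (simp add: card_image)
  also have "\<dots> \<le> card ?L" using sub fin by (rule card_mono[rotated])
  also have "\<dots> = card (pverts G) ^ Suc s" using card_lists_length_eq[OF pair_finite_verts] by simp
  also have "\<dots> \<le> card (pverts G) ^ l"
  proof -
    have "pverts G \<noteq> {}" using q by (cases ?q) (auto simp: s_arc_iff)
    then have "card (pverts G) \<ge> 1" using pair_finite_verts by (simp add: Suc_leI card_gt_0_iff)
    then show ?thesis using s(2) by (intro power_increasing) auto
  qed
  finally show "card ?A \<le> card (pverts G) ^ l" .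
qed

end

section \<open>Covers defined by congruences on walks\<close>

definition reduced :: "'a list \<Rightarrow> bool" where
  "reduced p \<longleftrightarrow> (\<forall>i. Suc (Suc i) < length p \<longrightarrow> p ! i \<noteq> p ! Suc (Suc i))"

text \<open>A walk is given by its initial vertex and the list of the vertices that follow it.\<close>

fun fin_vert :: "'a \<Rightarrow> 'a list \<Rightarrow> 'a" where
  "fin_vert v [] = v"
| "fin_vert v (x # xs) = fin_vert x xs"

text \<open>Since initial vertices are not listed, the reverse of a nonempty walk omits its own
  start \<open>fin_vert v xs\<close> and ends with \<open>v\<close>.\<close>

fun back_walk :: "'a \<Rightarrow> 'a list \<Rightarrow> 'a list" where
  "back_walk v [] = []"
| "back_walk v (x # xs) = back_walk x xs @ [v]"

fun walk :: "('a \<Rightarrow> 'a \<Rightarrow> bool) \<Rightarrow> 'a \<Rightarrow> 'a list \<Rightarrow> bool" where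
  "walk adj v [] \<longleftrightarrow> True"
| "walk adj v (x # xs) \<longleftrightarrow> adj v x \<and> walk adj x xs"

lemma fin_vert_append [simp]: "fin_vert v (xs @ ys) = fin_vert (fin_vert v xs) ys"
  by (induction xs arbitrary: v) auto

lemma walk_append [simp]: "walk adj v (xs @ ys) \<longleftrightarrow> walk adj v xs \<and> walk adj (fin_vert v xs) ys"
  by (induction xs arbitrary: v) auto

lemma fin_vert_back_walk [simp]: "fin_vert (fin_vert v xs) (back_walk v xs) = v"
  by (induction xs arbitrary: v) auto

lemma walk_back_walk:
  assumes "\<And>u v. adj u v \<Longrightarrow> adj v u" "walk adj v xs"
  shows "walk adj (fin_vert v xs) (back_walk v xs)"
  using assms(2) by (induction xs arbitrary: v) (auto simp: assms(1))

lemma fin_vert_map [simp]: "fin_vert (a v) (map a xs) = a (fin_vert v xs)"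
  by (induction xs arbitrary: v) auto

lemma back_walk_map: "back_walk (a v) (map a xs) = map a (back_walk v xs)"
  by (induction xs arbitrary: v) auto

lemma walk_take: "walk adj v xs \<Longrightarrow> walk adj v (take i xs)"
  by (metis append_take_drop_id walk_append)

lemma back_walk_append: "back_walk v (xs @ ys) = back_walk (fin_vert v xs) ys @ back_walk v xs"
  by (induction xs arbitrary: v) auto

lemma back_walk_back_walk [simp]: "back_walk (fin_vert v xs) (back_walk v xs) = xs"
  by (induction xs arbitrary: v) (auto simp: back_walk_append)

lemma fin_vert_take: "i \<le> length xs \<Longrightarrow> fin_vert v (take i xs) = (v # xs) ! i"
proof (induction xs arbitrary: v i)
  case (Cons x xs)
  then show ?case by (cases i) auto
qed auto

lemma walk_nth: "walk adj v xs \<Longrightarrow> i < length xs \<Longrightarrow> adj ((v # xs) ! i) (xs ! i)"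
proof (induction xs arbitrary: v i)
  case (Cons x xs)
  then show ?case by (cases i) auto
qed auto

text \<open>\<open>A\<close> is a finite 5-arc-transitive group of automorphisms. Its elements are
  bijections of the whole type, so that the group laws are equations between functions.\<close>

locale base_graph =
  fixes V :: "'a set" and adj :: "'a \<Rightarrow> 'a \<Rightarrow> bool" and A :: "('a \<Rightarrow> 'a) set" and v0 :: 'a
  assumes finite_V: "finite V" and v0: "v0 \<in> V"
    and adj_V: "adj u v \<Longrightarrow> u \<in> V" and adj_sym: "adj u v \<Longrightarrow> adj v u" and adj_irrefl: "\<not> adj v v"
    and degree: "v \<in> V \<Longrightarrow> card {w. adj v w} = 3"
    and finite_A: "finite A" and A_id: "id \<in> A"
    and A_comp: "a \<in> A \<Longrightarrow> b \<in> A \<Longrightarrow> a \<circ> b \<in> A"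
    and A_inv: "a \<in> A \<Longrightarrow> \<exists>b \<in> A. b \<circ> a = id \<and> a \<circ> b = id"
    and A_adj: "a \<in> A \<Longrightarrow> adj (a u) (a v) \<longleftrightarrow> adj u v"
    and A_vertices: "v \<in> V \<Longrightarrow> \<exists>a \<in> A. a v0 = v"
    and A_arcs: "\<lbrakk>u \<in> V; walk adj u xs; length xs = 5; reduced (u # xs);
      v \<in> V; walk adj v ys; length ys = 5; reduced (v # ys)\<rbrakk> \<Longrightarrow> \<exists>a \<in> A. a u = v \<and> map a xs = ys"
begin

lemma walk_map: "a \<in> A \<Longrightarrow> walk adj (a v) (map a xs) \<longleftrightarrow> walk adj v xs"
  by (induction xs arbitrary: v) (auto simp: A_adj)

lemma fin_vert_V: "v \<in> V \<Longrightarrow> walk adj v xs \<Longrightarrow> fin_vert v xs \<in> V"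
  by (induction xs arbitrary: v) (auto dest: adj_V adj_sym)

abbreviation walks :: "'a list set" where
  "walks \<equiv> {xs. walk adj v0 xs}"

end

text \<open>\<open>st xs\<close> is the end of the lift of the walk \<open>xs\<close> from the base
  vertex \<open>st []\<close> of the cover. The axioms make this end project to the base graph, make
  steps and backtracking lift, and make \<open>a\<close> lift to a map taking \<open>st []\<close>
  to \<open>st p\<close>, where \<open>p\<close> leads from \<open>v0\<close> to
  \<open>a v0\<close>.\<close>

locale regular_cover = base_graph +
  fixes st :: "'a list \<Rightarrow> 'v"
  assumes finite_st: "finite (st ` walks)"
    and st_fin_vert: "\<lbrakk>walk adj v0 xs; walk adj v0 ys; st xs = st ys\<rbrakk> \<Longrightarrow> fin_vert v0 xs = fin_vert v0 ys"
    and st_snoc: "\<lbrakk>walk adj v0 xs; walk adj v0 ys; st xs = st ys; adj (fin_vert v0 xs) x\<rbrakk>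
      \<Longrightarrow> st (xs @ [x]) = st (ys @ [x])"
    and st_backtrack: "\<lbrakk>walk adj v0 xs; adj (fin_vert v0 xs) x\<rbrakk>
      \<Longrightarrow> st (xs @ [x, fin_vert v0 xs]) = st xs"
    and st_lift: "\<lbrakk>a \<in> A; walk adj v0 p; fin_vert v0 p = a v0; walk adj v0 xs; walk adj v0 ys\<rbrakk>
      \<Longrightarrow> st (p @ map a xs) = st (p @ map a ys) \<longleftrightarrow> st xs = st ys"
begin

definition cover :: "'v pair_pre_digraph" where
  "cover = \<lparr>pverts = st ` walks, parcs = {(st xs, st (xs @ [x])) |xs x. walk adj v0 (xs @ [x])}\<rparr>"

lemma cover_simps [simp]: "pverts cover = st ` walks"
  by (simp add: cover_def)

lemma cover_arc_iff:
  assumes "walk adj v0 xs"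
  shows "(st xs, y) \<in> parcs cover \<longleftrightarrow> (\<exists>x. adj (fin_vert v0 xs) x \<and> y = st (xs @ [x]))" (is "?L \<longleftrightarrow> ?R")
proof
  assume ?L
  then obtain ys x where ys: "walk adj v0 ys" "st ys = st xs" "adj (fin_vert v0 ys) x" "y = st (ys @ [x])"
    by (auto simp: cover_def)
  then show ?R using st_snoc[OF ys(1) assms ys(2,3)] st_fin_vert[OF ys(1) assms ys(2)] by auto
next
  assume ?R
  then show ?L using assms by (force simp: cover_def)
qed

lemma st_append:
  assumes "walk adj v0 xs" "walk adj v0 ys" "st xs = st ys" "walk adj (fin_vert v0 xs) zs"
  shows "st (xs @ zs) = st (ys @ zs)"
  using assms(4)
proof (induction zs rule: rev_induct)
  case (snoc z zs)
  have "fin_vert v0 xs = fin_vert v0 ys" using st_fin_vert assms by blast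
  then show ?case using snoc assms st_snoc[of "xs @ zs" "ys @ zs" z] by auto
qed (use assms in auto)

lemma st_append_back_walk:
  assumes "walk adj v0 xs" "walk adj (fin_vert v0 xs) zs"
  shows "st (xs @ zs @ back_walk (fin_vert v0 xs) zs) = st xs"
  using assms
proof (induction zs arbitrary: xs)
  case (Cons z zs)
  let ?ys = "xs @ [z] @ zs @ back_walk z zs"
  have "st ?ys = st (xs @ [z])" using Cons.IH[of "xs @ [z]"] Cons.prems by auto
  then have "st (?ys @ [fin_vert v0 xs]) = st ((xs @ [z]) @ [fin_vert v0 xs])"
    using Cons.prems by (intro st_snoc) (auto intro: adj_sym walk_back_walk)
  then show ?case using st_backtrack[of xs z] Cons.prems by simp
qed auto

lemma cover_pair_graph: "pair_graph cover"
proof unfold_locales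
  fix e assume "e \<in> parcs cover"
  then show "fst e \<in> pverts cover" "snd e \<in> pverts cover" by (auto simp: cover_def)
  show "fst e \<noteq> snd e"
  proof
    assume "fst e = snd e"
    with \<open>e \<in> parcs cover\<close> obtain xs x where
      "walk adj v0 xs" "adj (fin_vert v0 xs) x" "st xs = st (xs @ [x])"
      by (auto simp: cover_def)
    then have "fin_vert v0 xs = x" using st_fin_vert[of xs "xs @ [x]"] by simp
    then show False using \<open>adj _ x\<close> adj_irrefl by simp
  qed
next
  show "finite (pverts cover)" using finite_st by simp
  moreover have "parcs cover \<subseteq> pverts cover \<times> pverts cover" by (auto simp: cover_def)
  ultimately show "finite (parcs cover)" by (meson finite_SigmaI finite_subset)
  have "(y, x) \<in> parcs cover" if "(x, y) \<in> parcs cover" for x y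
  proof -
    obtain xs z where xs: "walk adj v0 xs" "adj (fin_vert v0 xs) z" "x = st xs" "y = st (xs @ [z])"
      using \<open>(x, y) \<in> _\<close> by (auto simp: cover_def)
    then have "x = st ((xs @ [z]) @ [fin_vert v0 xs])" using st_backtrack by simp
    then show ?thesis using xs adj_sym cover_arc_iff[of "xs @ [z]" x] by auto
  qed
  then show "symmetric (with_proj cover)"
    by (auto simp: symmetric_def sym_def)
qed

lemma cover_connected: "Digraph_Component.connected (with_proj cover)"
proof -
  interpret pair_graph cover by (rule cover_pair_graph)
  have r: "st [] \<rightarrow>\<^sup>*\<^bsub>with_proj cover\<^esub> st xs" if "walk adj v0 xs" for xs
    using that
  proof (induction xs rule: rev_induct)
    case (snoc x xs)
    then have "(st xs, st (xs @ [x])) \<in> parcs cover" by (auto simp: cover_def)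
    then show ?case using snoc by (auto intro: reachable_adj_trans)
  qed (auto intro!: reachable_refl)
  have "strongly_connected (with_proj cover)"
  proof
    show "verts (with_proj cover) \<noteq> {}" by (auto intro: exI[of _ "[]"])
    fix u v assume "u \<in> verts (with_proj cover)" "v \<in> verts (with_proj cover)"
    then have "st [] \<rightarrow>\<^sup>*\<^bsub>with_proj cover\<^esub> u" "st [] \<rightarrow>\<^sup>*\<^bsub>with_proj cover\<^esub> v" using r by auto
    then show "u \<rightarrow>\<^sup>*\<^bsub>with_proj cover\<^esub> v"
      using symmetric_reachable[OF pair_sym_arcs] reachable_trans by blast
  qed
  moreover have "mk_symmetric (with_proj cover) = cover"
    unfolding mk_symmetric_def by (rule pair_pre_digraph.equality) (auto intro: arcs_symmetric)
  ultimately show ?thesis by (simp add: Digraph_Component.connected_def)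
qed

lemma cover_cubic: "valent 3 (with_proj cover)"
  unfolding valent_def
proof
  fix v assume "v \<in> verts (with_proj cover)"
  then obtain xs where xs: "walk adj v0 xs" "v = st xs" by auto
  let ?N = "{x. adj (fin_vert v0 xs) x}" and ?e = "\<lambda>x. (st xs, st (xs @ [x]))"
  have "out_arcs (with_proj cover) v = ?e ` ?N"
    using cover_arc_iff[OF xs(1)] xs(2) by (auto simp: out_arcs_def)
  moreover have "inj_on ?e ?N"
  proof
    fix x y assume xy: "x \<in> ?N" "y \<in> ?N" "?e x = ?e y"
    then show "x = y" using xs(1) st_fin_vert[of "xs @ [x]" "xs @ [y]"] by simp
  qed
  ultimately show "out_degree (with_proj cover) v = 3"
    using degree[OF fin_vert_V[OF v0 xs(1)]] by (simp add: out_degree_def card_image)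
qed

lemma cover_cubic_graph: "cubic_graph cover"
  using cover_pair_graph cover_connected cover_cubic
  by (simp add: cubic_graph_def cubic_graph_axioms_def)

text \<open>The lift of \<open>a\<close> that maps the base point to the end of the lift of the walk \<open>p\<close>.\<close>

definition lift :: "('a \<Rightarrow> 'a) \<Rightarrow> 'a list \<Rightarrow> 'v \<Rightarrow> 'v" where
  "lift a p v = st (p @ map a (SOME xs. walk adj v0 xs \<and> st xs = v))"

text \<open>By \<open>st_lift\<close> the value does not depend on which walk representing the
  vertex is picked.\<close>

lemma lift_st:
  assumes "a \<in> A" "walk adj v0 p" "fin_vert v0 p = a v0" "walk adj v0 xs"
  shows "lift a p (st xs) = st (p @ map a xs)"
proof -
  define ys where "ys = (SOME ys. walk adj v0 ys \<and> st ys = st xs)"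
  have "walk adj v0 ys \<and> st ys = st xs"
    unfolding ys_def using someI[of "\<lambda>ys. walk adj v0 ys \<and> st ys = st xs" xs] assms(4) by simp
  then show ?thesis using st_lift[OF assms(1-3), of ys xs] assms(4) unfolding lift_def ys_def by simp
qed

text \<open>\<open>st_lift\<close> gives injectivity, and finiteness of the cover turns this into
  bijectivity.\<close>

lemma vert_iso_lift:
  assumes a: "a \<in> A" and p: "walk adj v0 p" "fin_vert v0 p = a v0"
  shows "vert_iso cover cover (lift a p)"
proof -
  note lift = lift_st[OF a p]
  have w: "walk adj v0 (p @ map a xs) \<longleftrightarrow> walk adj v0 xs" for xs
    using p walk_map[OF a] by simp
  have "lift a p ` pverts cover \<subseteq> pverts cover" using lift w by auto
  moreover have inj: "inj_on (lift a p) (pverts cover)"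
    using lift st_lift[OF a p] by (auto simp: inj_on_def)
  ultimately have "bij_betw (lift a p) (pverts cover) (pverts cover)"
    using finite_st endo_inj_surj[of "pverts cover" "lift a p"] unfolding bij_betw_def by simp
  moreover have "(st xs, st ys) \<in> parcs cover \<longleftrightarrow> (lift a p (st xs), lift a p (st ys)) \<in> parcs cover"
    if xs: "walk adj v0 xs" and ys: "walk adj v0 ys" for xs ys
  proof -
    have fin: "fin_vert v0 (p @ map a xs) = a (fin_vert v0 xs)" using p by simp
    obtain b where b: "a \<circ> b = id" using A_inv[OF a] by blast
    have "(lift a p (st xs), lift a p (st ys)) \<in> parcs cover \<longleftrightarrow>
        (\<exists>x. adj (a (fin_vert v0 xs)) x \<and> st (p @ map a ys) = st (p @ map a xs @ [x]))"
      using cover_arc_iff[of "p @ map a xs"] w xs ys lift fin by simp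
    \<comment> \<open>Surjectivity of \<open>a\<close> lets every neighbour be written as
      \<open>a x\<close>.\<close>
    also have "\<dots> \<longleftrightarrow> (\<exists>x. adj (a (fin_vert v0 xs)) (a x) \<and> st (p @ map a ys) = st (p @ map a xs @ [a x]))"
      using b by (metis comp_apply id_apply)
    also have "\<dots> \<longleftrightarrow> (\<exists>x. adj (fin_vert v0 xs) x \<and> st ys = st (xs @ [x]))"
      using A_adj[OF a] st_lift[OF a p ys, of "xs @ [_]"] xs by auto
    also have "\<dots> \<longleftrightarrow> (st xs, st ys) \<in> parcs cover" using cover_arc_iff[OF xs] by simp
    finally show ?thesis by simp
  qed
  ultimately show ?thesis unfolding vert_iso_def by auto
qed

text \<open>The arcs of the cover are followed one at a time in the base graph. Backtracking below
  would mean backtracking above by \<open>st_backtrack\<close>, contrary to the arc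
  condition.\<close>

lemma s_arc_lift:
  assumes "s_arc (with_proj cover) s P"
  shows "\<exists>xs zs. walk adj v0 xs \<and> walk adj (fin_vert v0 xs) zs \<and> length zs = s \<and>
    reduced (fin_vert v0 xs # zs) \<and> (\<forall>i \<le> s. P ! i = st (xs @ take i zs))"
proof -
  interpret pair_graph cover by (rule cover_pair_graph)
  have P: "length P = Suc s" "\<And>i. i < s \<Longrightarrow> (P ! i, P ! Suc i) \<in> parcs cover"
    "\<And>i. Suc i < s \<Longrightarrow> P ! i \<noteq> P ! Suc (Suc i)" and "P ! 0 \<in> pverts cover"
    using assms nth_mem[of 0 P] unfolding s_arc_iff by auto
  then obtain xs where xs: "walk adj v0 xs" "P ! 0 = st xs" by auto
  have "\<exists>zs. walk adj (fin_vert v0 xs) zs \<and> length zs = k \<and> (\<forall>i \<le> k. P ! i = st (xs @ take i zs))"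
    if "k \<le> s" for k
    using that
  proof (induction k)
    case (Suc k)
    then obtain zs where zs: "walk adj (fin_vert v0 xs) zs" "length zs = k" "\<And>i. i \<le> k \<Longrightarrow> P ! i = st (xs @ take i zs)"
      by auto
    have "(st (xs @ zs), P ! Suc k) \<in> parcs cover"
      using P(2)[of k] Suc.prems zs(2) zs(3)[of k] by simp
    then obtain x where "adj (fin_vert v0 (xs @ zs)) x" "P ! Suc k = st (xs @ zs @ [x])"
      using cover_arc_iff[of "xs @ zs"] xs zs by auto
    then show ?case using zs by (intro exI[of _ "zs @ [x]"]) (auto simp: le_Suc_eq)
  qed (use xs in auto)
  then obtain zs where zs: "walk adj (fin_vert v0 xs) zs" "length zs = s" "\<And>i. i \<le> s \<Longrightarrow> P ! i = st (xs @ take i zs)"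
    by blast
  have "reduced (fin_vert v0 xs # zs)"
    unfolding reduced_def
  proof (intro allI impI notI)
    fix i assume i: "Suc (Suc i) < length (fin_vert v0 xs # zs)"
      and eq: "(fin_vert v0 xs # zs) ! i = (fin_vert v0 xs # zs) ! Suc (Suc i)"
    let ?ys = "xs @ take i zs"
    have "walk adj (fin_vert v0 xs) (take i zs)"
      using zs(1) by (rule walk_take)
    then have ys: "walk adj v0 ?ys" using xs by simp
    have fin: "fin_vert v0 ?ys = zs ! Suc i" "fin_vert v0 ?ys = (fin_vert v0 xs # zs) ! i"
      using i eq by (simp_all add: fin_vert_take)
    have "take (Suc (Suc i)) zs = take i zs @ [zs ! i, zs ! Suc i]"
      using i by (simp add: take_Suc_conv_app_nth)
    then have "P ! Suc (Suc i) = st (?ys @ [zs ! i, fin_vert v0 ?ys])"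
      using zs(2) zs(3)[of "Suc (Suc i)"] i fin(1) by simp
    also have "\<dots> = st ?ys"
      using ys walk_nth[OF zs(1), of i] i fin(2) by (intro st_backtrack) auto
    also have "\<dots> = P ! i" using zs(3)[of i] i zs(2) by simp
    finally show False using P(3)[of i] i zs(2) by simp
  qed
  then show ?thesis using xs(1) zs by blast
qed

lemma cover_5_arc_transitive: "s_arc_transitive 5 (with_proj cover)"
proof -
  interpret pair_graph cover by (rule cover_pair_graph)
  show ?thesis
    unfolding s_arc_transitive_iff_vert_iso[OF pair_wf_digraph]
  proof (intro allI impI, elim conjE)
    fix P Q assume PQ: "s_arc (with_proj cover) 5 P" "s_arc (with_proj cover) 5 Q"
    obtain xs zs where xs: "walk adj v0 xs" "walk adj (fin_vert v0 xs) zs" "length zs = 5"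
      "reduced (fin_vert v0 xs # zs)" "\<And>i. i \<le> 5 \<Longrightarrow> P ! i = st (xs @ take i zs)"
      using s_arc_lift[OF PQ(1)] by auto
    obtain ys ws where ys: "walk adj v0 ys" "walk adj (fin_vert v0 ys) ws" "length ws = 5"
      "reduced (fin_vert v0 ys # ws)" "\<And>i. i \<le> 5 \<Longrightarrow> Q ! i = st (ys @ take i ws)"
      using s_arc_lift[OF PQ(2)] by auto
    obtain a where a: "a \<in> A" "a (fin_vert v0 xs) = fin_vert v0 ys" "map a zs = ws"
      using A_arcs[of "fin_vert v0 xs" zs "fin_vert v0 ys" ws] xs ys fin_vert_V[OF v0] by auto
    \<comment> \<open>The walk \<open>?p\<close> continues \<open>ys\<close> by the image of the
      reverse of \<open>xs\<close>, so that the lift of \<open>a\<close> along it takes the end of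
      \<open>xs\<close> to the end of \<open>ys\<close>.\<close>
    let ?b = "map a (back_walk v0 xs)"
    let ?p = "ys @ ?b"
    have wb: "walk adj (fin_vert v0 ys) ?b"
      using walk_map[OF a(1), of "fin_vert v0 xs" "back_walk v0 xs"] walk_back_walk[OF adj_sym xs(1)] a(2)
      by simp
    have finb: "fin_vert (fin_vert v0 ys) ?b = a v0"
      using fin_vert_map[of a "fin_vert v0 xs" "back_walk v0 xs"] a(2) by simp
    have p: "walk adj v0 ?p" "fin_vert v0 ?p = a v0" using ys(1) wb finb by auto
    have "back_walk (fin_vert v0 ys) ?b = map a (back_walk (fin_vert v0 xs) (back_walk v0 xs))"
      using back_walk_map[of a "fin_vert v0 xs"] a(2) by simp
    also have "back_walk (fin_vert v0 xs) (back_walk v0 xs) = xs" by simp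
    finally have "st (?p @ map a xs) = st ys"
      using st_append_back_walk[OF ys(1) wb] by simp
    have "lift a ?p (st (xs @ take i zs)) = st (ys @ take i ws)" for i
    proof -
      have t: "walk adj (fin_vert v0 xs) (take i zs)" "walk adj (fin_vert v0 ys) (take i ws)"
        using xs(2) ys(2) by (auto intro: walk_take)
      have "lift a ?p (st (xs @ take i zs)) = st ((?p @ map a xs) @ take i ws)"
        using lift_st[OF a(1) p, of "xs @ take i zs"] xs(1) t(1) by (simp add: take_map a(3)[symmetric])
      also have "\<dots> = st (ys @ take i ws)"
        using \<open>st (?p @ map a xs) = st ys\<close> p t(2) ys(1) walk_map[OF a(1)] xs(1) a(2)
        by (intro st_append) auto
      finally show ?thesis .
    qed
    then have "map (lift a ?p) P = Q"
      using xs(5) ys(5) PQ by (intro nth_equalityI) (auto simp: s_arc_iff)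
    then show "\<exists>f. vert_iso cover cover f \<and> map f P = Q"
      using vert_iso_lift[OF a(1) p] by blast
  qed
qed

text \<open>The projection keeps apart the vertices two steps away from each other, so the lifted
  walk does not backtrack. The closed arc obtained is what bounds the automorphism group of the
  cover.\<close>

lemma closed_s_arc:
  assumes "walk adj v0 zs" "reduced (v0 # zs)" "st zs = st []"
  shows "\<exists>P. s_arc (with_proj cover) (length zs) P \<and> P ! 0 = P ! length zs"
proof -
  interpret pair_graph cover by (rule cover_pair_graph)
  define P where "P = map (\<lambda>i. st (take i zs)) [0..<Suc (length zs)]"
  have w: "walk adj v0 (take i zs)" for i
    using assms(1) by (rule walk_take)
  have len: "length P = Suc (length zs)" by (simp add: P_def)
  have P: "P ! i = st (take i zs)" if "i \<le> length zs" for i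
    using that unfolding P_def by (simp del: upt_Suc)
  have arcs: "(P ! i, P ! Suc i) \<in> parcs cover" if i: "i < length zs" for i
  proof -
    have "adj (fin_vert v0 (take i zs)) (zs ! i)"
      using walk_nth[OF assms(1) i] i by (simp add: fin_vert_take)
    then have "(st (take i zs), st (take i zs @ [zs ! i])) \<in> parcs cover"
      using cover_arc_iff[OF w] by blast
    then show ?thesis using P[of i] P[of "Suc i"] i by (simp add: take_Suc_conv_app_nth)
  qed
  have red: "P ! i \<noteq> P ! Suc (Suc i)" if i: "Suc i < length zs" for i
  proof
    assume "P ! i = P ! Suc (Suc i)"
    then have "st (take i zs) = st (take (Suc (Suc i)) zs)" using P[of i] P[of "Suc (Suc i)"] i by simp
    then have "(v0 # zs) ! i = (v0 # zs) ! Suc (Suc i)"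
      using st_fin_vert[OF w w, of i "Suc (Suc i)"] i fin_vert_take[of i zs v0] fin_vert_take[of "Suc (Suc i)" zs v0]
      by simp
    then show False using assms(2) i unfolding reduced_def by auto
  qed
  have "set P \<subseteq> pverts cover" unfolding P_def using w assms(1) by auto
  then have "s_arc (with_proj cover) (length zs) P"
    unfolding s_arc_iff using len arcs red by blast
  moreover have "P ! 0 = P ! length zs" using P[of 0] P[of "length zs"] assms(3) by simp
  ultimately show ?thesis by blast
qed

end

text \<open>The lifts of three automorphisms moving the base point to its neighbours, together with the
  image of the base point, trace the lift of every walk.\<close>

lemma (in base_graph) covers_agree:
  assumes "regular_cover V adj A v0 st" "regular_cover V adj A v0 st'"
    and a: "\<And>x. adj v0 x \<Longrightarrow> a x \<in> A \<and> a x v0 = x"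
    and base: "f (st []) = f' (st' [])"
    and h: "\<And>x xs. adj v0 x \<Longrightarrow> walk adj v0 xs \<Longrightarrow> f (regular_cover.lift adj v0 st (a x) [x] (st xs)) = h x (f (st xs))"
    and h': "\<And>x xs. adj v0 x \<Longrightarrow> walk adj v0 xs \<Longrightarrow> f' (regular_cover.lift adj v0 st' (a x) [x] (st' xs)) = h x (f' (st' xs))"
    and "walk adj v0 xs"
  shows "f (st xs) = f' (st' xs)"
proof -
  interpret C: regular_cover V adj A v0 st by fact
  interpret C': regular_cover V adj A v0 st' by fact
  show ?thesis using \<open>walk adj v0 xs\<close>
  proof (induction "length xs" arbitrary: xs rule: less_induct)
    case less
    show ?case
    proof (cases xs)
      case Nil
      then show ?thesis using base by simp
    next
      case (Cons x zs)
      then have x: "adj v0 x" "walk adj x zs" using less.prems by auto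
      note ax = a[OF x(1)]
      \<comment> \<open>Pulling the rest of the walk back by the inverse of \<open>a x\<close> gives
        a shorter walk from the base point, whose end in the cover is carried to that of
        \<open>xs\<close> by the lift of \<open>a x\<close>.\<close>
      obtain b where b: "b \<in> A" "a x \<circ> b = id" "b \<circ> a x = id" using A_inv ax by blast
      have "walk adj v0 (map b zs)"
        using walk_map[OF b(1), of x zs] x(2) fun_cong[OF b(3), of v0] ax by simp
      moreover have zs: "xs = [x] @ map (a x) (map b zs)" using Cons b(2) by simp
      moreover have "walk adj v0 [x]" "fin_vert v0 [x] = a x v0" using ax x by auto
      ultimately have "st xs = C.lift (a x) [x] (st (map b zs))" "st' xs = C'.lift (a x) [x] (st' (map b zs))"
        using C.lift_st[of "a x" "[x]" "map b zs"] C'.lift_st[of "a x" "[x]" "map b zs"] ax by auto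
      moreover have "f (st (map b zs)) = f' (st' (map b zs))"
        using less.hyps[of "map b zs"] \<open>walk adj v0 (map b zs)\<close> Cons by simp
      ultimately show ?thesis
        using h[OF x(1) \<open>walk adj v0 (map b zs)\<close>] h'[OF x(1) \<open>walk adj v0 (map b zs)\<close>] by simp
    qed
  qed
qed

section \<open>Covers from voltages in a monoid\<close>

fun vol :: "('a \<Rightarrow> 'a \<Rightarrow> 'g) \<Rightarrow> 'a \<Rightarrow> 'a list \<Rightarrow> 'g::monoid_mult" where
  "vol \<phi> v [] = 1"
| "vol \<phi> v (x # xs) = \<phi> v x * vol \<phi> x xs"

lemma vol_append [simp]: "vol \<phi> v (xs @ ys) = vol \<phi> v xs * vol \<phi> (fin_vert v xs) ys"
  by (induction xs arbitrary: v) (auto simp: mult.assoc)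

lemma card_image_le_if_factors:
  assumes "\<And>x y. x \<in> S \<Longrightarrow> y \<in> S \<Longrightarrow> g x = g y \<Longrightarrow> f x = f y" "finite (g ` S)"
  shows "finite (f ` S)" "card (f ` S) \<le> card (g ` S)"
proof -
  have "f x = f (inv_into S g (g x))" if "x \<in> S" for x
    using that by (intro assms(1)) (auto simp: inv_into_into f_inv_into_f)
  then have eq: "f ` S = (\<lambda>z. f (inv_into S g z)) ` g ` S"
    unfolding image_image by (rule image_cong[OF refl])
  show "finite (f ` S)" unfolding eq using assms(2) by (rule finite_imageI)
  show "card (f ` S) \<le> card (g ` S)" unfolding eq using assms(2) by (rule card_image_le)
qed

text \<open>The voltages range over a monoid because \<open>hall\<close> admits arbitrary diagonal
  entries; invertibility is imposed on the arcs.\<close>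

locale voltage_graph = base_graph V adj A v0
  for V :: "'a set" and adj A v0 +
  fixes \<phi> :: "'a \<Rightarrow> 'a \<Rightarrow> 'g::monoid_mult"
  assumes \<phi>_inverse: "adj u v \<Longrightarrow> \<phi> u v * \<phi> v u = 1"
begin

lemma vol_back_walk:
  assumes "walk adj v xs"
  shows "vol \<phi> v xs * vol \<phi> (fin_vert v xs) (back_walk v xs) = 1"
  using assms
proof (induction xs arbitrary: v)
  case (Cons x xs)
  have "vol \<phi> v (x # xs) * vol \<phi> (fin_vert v (x # xs)) (back_walk v (x # xs))
      = \<phi> v x * (vol \<phi> x xs * vol \<phi> (fin_vert x xs) (back_walk x xs)) * \<phi> x v"
    by (simp add: mult.assoc)
  then show ?case using Cons \<phi>_inverse by simp
qed auto

lemma back_walk_vol: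
  assumes "walk adj v xs"
  shows "vol \<phi> (fin_vert v xs) (back_walk v xs) * vol \<phi> v xs = 1"
  using vol_back_walk[OF walk_back_walk[OF adj_sym assms]] by simp

definition walk_cong :: "('g \<Rightarrow> 'g \<Rightarrow> bool) \<Rightarrow> 'a list \<Rightarrow> 'a list \<Rightarrow> bool" where
  "walk_cong R xs ys \<longleftrightarrow> fin_vert v0 xs = fin_vert v0 ys \<and>
    (\<forall>a \<in> A. R (vol \<phi> (a v0) (map a xs)) (vol \<phi> (a v0) (map a ys)))"

text \<open>The lifting axiom is the main point: the voltage of \<open>b\<close> applied to
  \<open>p @ map a xs\<close> is an invertible factor depending only on \<open>b\<close> and
  \<open>p\<close>, times the voltage of \<open>b \<circ> a\<close> applied to \<open>xs\<close>. As
  \<open>b\<close> runs through \<open>A\<close>, so does \<open>b \<circ> a\<close>.\<close>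

lemma regular_cover_of_congruence:
  fixes st :: "'a list \<Rightarrow> 'v"
  assumes refl: "\<And>x. R x x"
    and mult: "\<And>x x' y y'. R x x' \<Longrightarrow> R y y' \<Longrightarrow> R (x * y) (x' * y')"
    and fin: "finite (st ` walks)"
    and st: "\<And>xs ys. walk adj v0 xs \<Longrightarrow> walk adj v0 ys \<Longrightarrow> st xs = st ys \<longleftrightarrow> walk_cong R xs ys"
  shows "regular_cover V adj A v0 st"
proof unfold_locales
  show "finite (st ` walks)" by fact
next
  fix xs ys assume "walk adj v0 xs" "walk adj v0 ys" "st xs = st ys"
  then show "fin_vert v0 xs = fin_vert v0 ys" using st by (simp add: walk_cong_def)
next
  fix xs ys x
  assume *: "walk adj v0 xs" "walk adj v0 ys" "st xs = st ys" "adj (fin_vert v0 xs) x"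
  then have "walk_cong R xs ys" using st by simp
  then have "walk_cong R (xs @ [x]) (ys @ [x])"
    by (auto simp: walk_cong_def intro!: mult refl)
  then show "st (xs @ [x]) = st (ys @ [x])"
    using * st \<open>walk_cong R xs ys\<close> by (auto simp: walk_cong_def)
next
  fix xs x
  assume *: "walk adj v0 xs" "adj (fin_vert v0 xs) x"
  have "walk_cong R (xs @ [x, fin_vert v0 xs]) xs"
    unfolding walk_cong_def using * A_adj \<phi>_inverse
    by (auto simp: refl)
  then show "st (xs @ [x, fin_vert v0 xs]) = st xs"
    using st[of "xs @ [x, fin_vert v0 xs]" xs] * adj_sym by auto
next
  fix a p xs ys
  assume a: "a \<in> A" and p: "walk adj v0 p" "fin_vert v0 p = a v0" and w: "walk adj v0 xs" "walk adj v0 ys"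
  let ?v = "\<lambda>b xs. vol \<phi> (b v0) (map b xs)"
  have split: "?v b (p @ map a zs) = ?v b p * ?v (b \<circ> a) zs" for b zs
    using fin_vert_map[of b v0 p] p(2) by simp
  have cancel: "R (?v b p * y) (?v b p * z) \<longleftrightarrow> R y z" if "b \<in> A" for b y z
  proof
    let ?w = "vol \<phi> (fin_vert (b v0) (map b p)) (back_walk (b v0) (map b p))"
    assume "R (?v b p * y) (?v b p * z)"
    then have "R (?w * (?v b p * y)) (?w * (?v b p * z))" by (rule mult[OF refl])
    moreover have "?w * ?v b p = 1"
      using walk_map[OF that] p(1) by (intro back_walk_vol) blast
    then have "?w * (?v b p * t) = t" for t
      unfolding mult.assoc[symmetric] by simp
    ultimately show "R y z" by metis
  next
    assume "R y z"
    then show "R (?v b p * y) (?v b p * z)" by (rule mult[OF refl])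
  qed
  have "inj a" using A_inv[OF a] by (metis inj_on_id inj_on_imageI2)
  obtain a' where a': "a' \<in> A" "a' \<circ> a = id" using A_inv[OF a] by blast
  have "(\<forall>b \<in> A. P (b \<circ> a)) \<longleftrightarrow> (\<forall>b \<in> A. P b)" for P
  proof
    assume "\<forall>b \<in> A. P (b \<circ> a)"
    moreover have "b \<circ> a' \<in> A" "(b \<circ> a') \<circ> a = b" if "b \<in> A" for b
      using A_comp[OF that a'(1)] a'(2) by (auto simp: comp_assoc)
    ultimately show "\<forall>b \<in> A. P b" by metis
  qed (use A_comp a in blast)
  from this[of "\<lambda>b. R (?v b xs) (?v b ys)"]
  have "walk_cong R (p @ map a xs) (p @ map a ys) \<longleftrightarrow> walk_cong R xs ys"
    unfolding walk_cong_def split using cancel \<open>inj a\<close> p by (auto simp: inj_eq)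
  then show "st (p @ map a xs) = st (p @ map a ys) \<longleftrightarrow> st xs = st ys"
    using st p w walk_map[OF a] by simp
qed

text \<open>The predicates \<open>R x\<close> are the classes of \<open>R\<close>, so
  \<open>f\<close> records the vertex reached by a walk. The finer invariant \<open>q\<close> has
  finitely many values, which bounds the number of vertices; these are then numbered to obtain a
  graph on natural numbers.\<close>

lemma ex_regular_cover:
  assumes "equivp R"
    and mult: "\<And>x x' y y'. R x x' \<Longrightarrow> R y y' \<Longrightarrow> R (x * y) (x' * y')"
    and q: "\<And>x y. q x = q y \<Longrightarrow> R x y" "\<And>x. q x \<in> K" and K: "finite K"
  obtains st :: "'a list \<Rightarrow> nat" where "regular_cover V adj A v0 st"
    and "\<And>xs ys. walk adj v0 xs \<Longrightarrow> walk adj v0 ys \<Longrightarrow> st xs = st ys \<longleftrightarrow> walk_cong R xs ys"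
    and "card (st ` walks) \<le> card V * card K ^ card A"
proof -
  define f where "f xs = (fin_vert v0 xs, \<lambda>a \<in> A. R (vol \<phi> (a v0) (map a xs)))" for xs
  define g where "g xs = (fin_vert v0 xs, \<lambda>a \<in> A. q (vol \<phi> (a v0) (map a xs)))" for xs
  have R: "R x y \<longleftrightarrow> R x = R y" for x y
    using assms(1)[unfolded equivp_def, THEN spec, THEN spec] .
  have f: "f xs = f ys \<longleftrightarrow> walk_cong R xs ys" for xs ys
  proof -
    have "restrict h A = restrict h' A \<longleftrightarrow> (\<forall>a \<in> A. h a = h' a)" for h h' :: "('a \<Rightarrow> 'a) \<Rightarrow> 'g \<Rightarrow> bool"
    proof
      assume "restrict h A = restrict h' A"
      then show "\<forall>a \<in> A. h a = h' a" using fun_cong[of "restrict h A" "restrict h' A"] by (metis restrict_apply')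
    qed (blast intro: restrict_ext)
    then show ?thesis by (simp only: f_def walk_cong_def prod.inject R)
  qed
  have gf: "f xs = f ys" if "g xs = g ys" for xs ys
  proof -
    have eq: "fin_vert v0 xs = fin_vert v0 ys"
      "(\<lambda>a \<in> A. q (vol \<phi> (a v0) (map a xs))) = (\<lambda>a \<in> A. q (vol \<phi> (a v0) (map a ys)))"
      using that by (simp_all add: g_def)
    have "q (vol \<phi> (a v0) (map a xs)) = q (vol \<phi> (a v0) (map a ys))" if "a \<in> A" for a
      using fun_cong[OF eq(2), of a] that by simp
    then show ?thesis unfolding f walk_cong_def using eq(1) q(1) by blast
  qed
  have "g ` walks \<subseteq> V \<times> (A \<rightarrow>\<^sub>E K)" using q(2) fin_vert_V[OF v0] by (auto simp: g_def)
  moreover have fin: "finite (V \<times> (A \<rightarrow>\<^sub>E K))" using finite_V K finite_A by (simp add: finite_PiE)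
  ultimately have g_walks: "finite (g ` walks)" by (rule finite_subset)
  have "finite (f ` walks)" "card (f ` walks) \<le> card (g ` walks)"
    by (rule card_image_le_if_factors[where g = g], erule gf, rule g_walks)+
  moreover have "card (g ` walks) \<le> card (V \<times> (A \<rightarrow>\<^sub>E K))"
    using \<open>g ` walks \<subseteq> _\<close> fin by (rule card_mono[rotated])
  ultimately have f_walks: "finite (f ` walks)" "card (f ` walks) \<le> card V * card K ^ card A"
    using finite_A by (auto simp: card_cartesian_product card_PiE)
  define st where "st xs = to_nat_on (f ` walks) (f xs)" for xs
  have st: "st xs = st ys \<longleftrightarrow> walk_cong R xs ys" if "walk adj v0 xs" "walk adj v0 ys" for xs ys
    unfolding st_def f[symmetric]
    using inj_on_to_nat_on[OF countable_finite[OF f_walks(1)]] that by (simp add: inj_on_eq_iff)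
  have im: "st ` walks = to_nat_on (f ` walks) ` f ` walks" by (auto simp: st_def)
  have "regular_cover V adj A v0 st"
  proof (rule regular_cover_of_congruence[of R])
    show "R x x" for x using assms(1) by (rule equivp_reflp)
    show "finite (st ` walks)" unfolding im using f_walks(1) by simp
  qed (fact mult st)+
  moreover have "card (st ` walks) \<le> card V * card K ^ card A"
    unfolding im using card_image_le[OF f_walks(1)] f_walks(2) by (rule order_trans)
  ultimately show thesis using that st by blast
qed

end

section \<open>The voltage group\<close>

text \<open>\<open>Hall g a b c\<close> stands for the matrix with rows \<open>(1, a, c)\<close>, \<open>(0, g, b)\<close>, \<open>(0, 0, 1)\<close>. The
  second derived group of the group of these matrices consists of central matrices \<open>Hall 1 0 0 c\<close>.\<close>

datatype 'r hall = Hall (diag: 'r) (upper: 'r) (right: 'r) (corner: 'r)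

instantiation hall :: (comm_ring_1) monoid_mult
begin

definition one_hall_def: "1 = Hall 1 0 0 0"

definition times_hall_def: "x * y = Hall (diag x * diag y) (upper y + upper x * diag y)
  (diag x * right y + right x) (corner x + corner y + upper x * right y)"

instance
  by standard (auto simp: one_hall_def times_hall_def algebra_simps)

end

lemmas hall_simps = one_hall_def times_hall_def

lemma hall_inverse:
  fixes x :: "'r::comm_ring_1 hall"
  assumes "x * x' = 1"
  shows "diag x * diag x' = 1" "upper x' = - upper x * diag x'" "right x = - diag x * right x'"
    "corner x' = - corner x - upper x * right x'"
  using assms by (auto simp: hall_simps eq_neg_iff_add_eq_0 add.commute algebra_simps)

lemma diag_commutator:
  fixes x y :: "'r::comm_ring_1 hall"
  assumes "x * x' = 1" "y * y' = 1"
  shows "diag (x * y * x' * y') = 1"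
proof -
  have "diag (x * y * x' * y') = (diag x * diag x') * (diag y * diag y')"
    by (simp add: hall_simps algebra_simps)
  then show ?thesis using hall_inverse(1)[OF assms(1)] hall_inverse(1)[OF assms(2)] by simp
qed

text \<open>Matrices with diagonal entry one form a Heisenberg group, whose commutators are central
  and given by an alternating form in the upper and right entries.\<close>

lemma hall_commutator:
  fixes x y :: "'r::comm_ring_1 hall"
  assumes "x * x' = 1" "y * y' = 1" "diag x = 1" "diag y = 1"
  shows "x * y * x' * y' = Hall 1 0 0 (upper x * right y - upper y * right x)"
proof -
  have inv: "z' = Hall 1 (- upper z) (- right z) (upper z * right z - corner z)"
    if "z * z' = 1" "diag z = 1" for z z' :: "'r hall"
    using hall_inverse[OF that(1)] that(2) by (cases z') auto
  show ?thesis
    unfolding inv[OF assms(1,3)] inv[OF assms(2,4)] using assms(3,4)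
    by (simp add: hall_simps algebra_simps)
qed

lemma Hall_center_mult: "Hall 1 0 0 x * Hall 1 0 0 y = Hall 1 0 0 (x + y)"
  by (simp add: hall_simps)

definition hall_cong :: "'r::comm_ring_1 set \<Rightarrow> 'r set \<Rightarrow> 'r hall \<Rightarrow> 'r hall \<Rightarrow> bool" where
  "hall_cong I W x y \<longleftrightarrow> diag x - diag y \<in> I \<and> upper x - upper y \<in> I \<and> right x - right y \<in> I \<and>
    corner x - corner y \<in> W"

definition add_subgroup :: "'r::ab_group_add set \<Rightarrow> bool" where
  "add_subgroup W \<longleftrightarrow> 0 \<in> W \<and> (\<forall>x \<in> W. \<forall>y \<in> W. x - y \<in> W)"

lemma add_subgroupD:
  assumes "add_subgroup W"
  shows "0 \<in> W" "x \<in> W \<Longrightarrow> y \<in> W \<Longrightarrow> x - y \<in> W" "x \<in> W \<Longrightarrow> - x \<in> W" "x \<in> W \<Longrightarrow> y \<in> W \<Longrightarrow> x + y \<in> W"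
proof -
  have d: "x - y \<in> W" if "x \<in> W" "y \<in> W" for x y
    using assms that by (auto simp: add_subgroup_def)
  show 0: "0 \<in> W" using assms by (simp add: add_subgroup_def)
  have n: "- x \<in> W" if "x \<in> W" for x using d[OF 0 that] by simp
  show "x \<in> W \<Longrightarrow> y \<in> W \<Longrightarrow> x - y \<in> W" "x \<in> W \<Longrightarrow> - x \<in> W" by (fact d n)+
  show "x \<in> W \<Longrightarrow> y \<in> W \<Longrightarrow> x + y \<in> W" using d[OF _ n, of x y] by simp
qed

lemma equivp_hall_cong:
  assumes "add_subgroup I" "add_subgroup W"
  shows "equivp (hall_cong I W)"
proof (rule equivpI)
  show "reflp (hall_cong I W)"
    using assms by (auto simp: reflp_def hall_cong_def add_subgroupD)
  show "symp (hall_cong I W)"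
  proof
    have "y - x \<in> U" if "add_subgroup U" "x - y \<in> U" for U :: "'a set" and x y
      using add_subgroupD(3)[OF that] by simp
    then show "hall_cong I W y x" if "hall_cong I W x y" for x y
      using that assms by (auto simp: hall_cong_def)
  qed
  have t: "x - z \<in> U" if "add_subgroup U" "x - y \<in> U" "y - z \<in> U" for U :: "'a set" and x y z
    using add_subgroupD(4)[OF that] by simp
  show "transp (hall_cong I W)"
    using assms by (auto simp: transp_def hall_cong_def intro: t)
qed

text \<open>Corners add up to a term \<open>upper x * right y\<close>, which is well defined modulo
  \<open>I\<close>. Hence \<open>W\<close> may be any additive subgroup containing \<open>I\<close>;
  this freedom produces the many covers.\<close>

lemma hall_cong_mult:
  assumes I: "add_subgroup I" "\<And>x y. x \<in> I \<Longrightarrow> x * y \<in> I" and W: "add_subgroup W" "I \<subseteq> W"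
    and x: "hall_cong I W x x'" and y: "hall_cong I W y y'"
  shows "hall_cong I W (x * y) (x' * y')"
proof -
  have mult: "a * b - a' * b' \<in> I" if "a - a' \<in> I" "b - b' \<in> I" for a a' b b'
  proof -
    have "a * b - a' * b' = (a - a') * b + (b - b') * a'" by (simp add: algebra_simps)
    then show ?thesis using I that by (simp add: add_subgroupD(4))
  qed
  have add: "(a + b) - (a' + b') \<in> U" if "add_subgroup U" "a - a' \<in> U" "b - b' \<in> U" for U :: "'a set" and a a' b b'
    using add_subgroupD(4)[OF that] by (simp add: algebra_simps)
  show ?thesis
    using x y W unfolding hall_cong_def times_hall_def
    by (auto intro!: add mult I W(1))
qed

section \<open>Power series truncations and subset sums\<close>

definition fps_ideal :: "nat \<Rightarrow> 'r::comm_ring_1 fps set" where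
  "fps_ideal m = {f. \<forall>n < m. fps_nth f n = 0}"

lemma add_subgroup_fps_ideal: "add_subgroup (fps_ideal m)"
  by (simp add: add_subgroup_def fps_ideal_def)

lemma fps_ideal_mult:
  assumes "f \<in> fps_ideal m"
  shows "f * g \<in> fps_ideal m"
proof -
  have "fps_nth (f * g) n = 0" if "n < m" for n
    unfolding fps_mult_nth using assms that by (intro sum.neutral) (auto simp: fps_ideal_def)
  then show ?thesis by (simp add: fps_ideal_def)
qed

definition fps_trunc :: "nat \<Rightarrow> 'r::comm_ring_1 fps \<Rightarrow> nat \<Rightarrow> 'r" where
  "fps_trunc m f = restrict (fps_nth f) {..<m}"

lemma fps_trunc_eqD:
  assumes "fps_trunc m f = fps_trunc m g"
  shows "f - g \<in> fps_ideal m"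
proof -
  have "fps_nth f n = fps_nth g n" if "n < m" for n
    using fun_cong[OF assms, of n] that by (simp add: fps_trunc_def)
  then show ?thesis by (simp add: fps_ideal_def)
qed

definition hall_trunc ::
  "nat \<Rightarrow> 'r::comm_ring_1 fps hall \<Rightarrow> (nat \<Rightarrow> 'r) \<times> (nat \<Rightarrow> 'r) \<times> (nat \<Rightarrow> 'r) \<times> (nat \<Rightarrow> 'r)" where
  "hall_trunc m x = (fps_trunc m (diag x), fps_trunc m (upper x), fps_trunc m (right x), fps_trunc m (corner x))"

abbreviation (input) bit_tuples :: "nat \<Rightarrow> (nat \<Rightarrow> bit) set" where
  "bit_tuples m \<equiv> {..<m} \<rightarrow>\<^sub>E UNIV"

definition hall_truncs :: "nat \<Rightarrow> ((nat \<Rightarrow> bit) \<times> (nat \<Rightarrow> bit) \<times> (nat \<Rightarrow> bit) \<times> (nat \<Rightarrow> bit)) set" where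
  "hall_truncs m = bit_tuples m \<times> bit_tuples m \<times> bit_tuples m \<times> bit_tuples m"

lemma UNIV_bit: "(UNIV :: bit set) = {0, 1}"
  using bit_not_zero_iff by blast

lemma hall_truncs: "hall_trunc m x \<in> hall_truncs m" "finite (hall_truncs m)" "card (hall_truncs m) = 2 ^ (4 * m)"
proof -
  show "hall_trunc m x \<in> hall_truncs m"
    by (auto simp: hall_trunc_def hall_truncs_def fps_trunc_def)
  have "card (UNIV :: bit set) = 2" "finite (UNIV :: bit set)" by (simp_all add: UNIV_bit)
  then have "finite (bit_tuples m)" "card (bit_tuples m) = 2 ^ m"
    by (simp_all add: finite_PiE card_PiE)
  then show "finite (hall_truncs m)" "card (hall_truncs m) = 2 ^ (4 * m)"
    by (simp_all add: hall_truncs_def card_cartesian_product power_mult_distrib flip: power_add)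
qed

lemma hall_trunc_eqD:
  assumes "hall_trunc m x = hall_trunc m y" "fps_ideal m \<subseteq> W"
  shows "hall_cong (fps_ideal m) W x y"
  using assms fps_trunc_eqD by (auto simp: hall_trunc_def hall_cong_def)

lemma fps_bit_add_self: "(f :: bit fps) + f = 0"
proof (rule fps_ext)
  fix n
  show "fps_nth (f + f) n = fps_nth 0 n"
    unfolding fps_add_nth fps_zero_nth by (cases "fps_nth f n") simp_all
qed

text \<open>Over the two-element field all coefficients are 0 or 1, so this is the span of the
  values of \<open>g\<close> on \<open>S\<close>, enlarged by \<open>I\<close>.\<close>

definition subset_sums :: "('i \<Rightarrow> 'r) \<Rightarrow> 'i set \<Rightarrow> 'r::ab_group_add set \<Rightarrow> 'r set" where
  "subset_sums g S I = {sum g s + i |s i. s \<subseteq> S \<and> i \<in> I}"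

lemma subset_sumsI: "s \<subseteq> S \<Longrightarrow> i \<in> I \<Longrightarrow> sum g s + i \<in> subset_sums g S I"
  unfolding subset_sums_def by blast

text \<open>In characteristic two the difference of two subset sums is the sum over the symmetric
  difference.\<close>

lemma add_subgroup_subset_sums:
  fixes I :: "'r::ab_group_add set"
  assumes S: "finite S" and I: "add_subgroup I" and char_2: "\<And>x :: 'r. x + x = 0"
  shows "add_subgroup (subset_sums g S I)"
  unfolding add_subgroup_def
proof (intro conjI ballI)
  show "(0 :: 'r) \<in> subset_sums g S I"
    using subset_sumsI[of "{}" S 0 I g] add_subgroupD(1)[OF I] by simp
  fix x y assume "x \<in> subset_sums g S I" "y \<in> subset_sums g S I"
  then obtain s t i j where x: "x = sum g s + i" "s \<subseteq> S" "i \<in> I" and y: "y = sum g t + j" "t \<subseteq> S" "j \<in> I"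
    by (auto simp: subset_sums_def)
  have fin: "finite s" "finite t" using x(2) y(2) S finite_subset by auto
  have minus: "- z = z" for z :: 'r using char_2[of z] by (rule minus_unique)
  have "sum g s = sum g (s - t) + sum g (s \<inter> t)" "sum g t = sum g (t - s) + sum g (s \<inter> t)"
    using fin sum.Int_Diff[of s g t] sum.Int_Diff[of t g s] by (simp_all add: add.commute Int_commute)
  then have "sum g s - sum g t = sum g (s - t) + - sum g (t - s)" by simp
  also have "\<dots> = sum g ((s - t) \<union> (t - s))"
    unfolding minus using fin by (intro sum.union_disjoint[symmetric]) auto
  finally have "x - y = sum g ((s - t) \<union> (t - s)) + (i - j)" using x y by (simp add: algebra_simps)
  moreover have "(s - t) \<union> (t - s) \<subseteq> S" "i - j \<in> I" using x y add_subgroupD(2)[OF I] by auto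
  ultimately show "x - y \<in> subset_sums g S I" unfolding subset_sums_def by blast
qed

lemma subset_sums_superset: "I \<subseteq> subset_sums g S I"
  using subset_sumsI[of "{}" S _ I g] by auto

lemma subset_sums_member: "add_subgroup I \<Longrightarrow> s \<in> S \<Longrightarrow> g s \<in> subset_sums g S I"
  using subset_sumsI[of "{s}" S 0 I g] add_subgroupD(1)[of I] by simp

section \<open>Independence of the powers of 1 + X\<close>

lemma one_plus_X_power_nth:
  "n \<ge> i \<Longrightarrow> fps_nth ((1 + fps_X :: 'r::comm_ring_1 fps) ^ i) n = (if n = i then 1 else 0)"
proof (induction i arbitrary: n)
  case (Suc i)
  have "fps_nth ((1 + fps_X :: 'r fps) ^ Suc i) n = fps_nth ((1 + fps_X) ^ i) n + fps_nth (fps_X * (1 + fps_X) ^ i) n"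
    by (simp add: algebra_simps)
  then show ?case using Suc by (auto simp: fps_X_mult_nth)
qed (auto simp: fps_one_nth)

text \<open>The \<open>i\<close>-th power is monic of degree \<open>i\<close>, so the top
  coefficient decides whether the largest index belongs to each set, and its term can be removed
  from both sums.\<close>

lemma one_plus_X_powers_independent:
  assumes "c \<subseteq> {..<r}" "c' \<subseteq> {..<r}"
    and "(\<Sum>i\<in>c. (1 + fps_X :: 'r::comm_ring_1 fps) ^ i) - (\<Sum>i\<in>c'. (1 + fps_X) ^ i) \<in> fps_ideal r"
  shows "c = c'"
  using assms
proof (induction r arbitrary: c c')
  case (Suc r)
  let ?p = "\<lambda>c. \<Sum>i\<in>c. (1 + fps_X :: 'r fps) ^ i"
  have top: "fps_nth (?p c) r = (if r \<in> c then 1 else 0)" if "c \<subseteq> {..<Suc r}" for c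
  proof -
    have fin: "finite c" using that finite_subset by blast
    have "fps_nth (?p c) r = (\<Sum>i\<in>c. if r = i then 1 else 0)"
      unfolding fps_sum_nth using that by (intro sum.cong one_plus_X_power_nth) auto
    then show ?thesis using fin by simp
  qed
  have rem: "?p c = ?p (c - {r}) + (if r \<in> c then (1 + fps_X) ^ r else 0)" if "c \<subseteq> {..<Suc r}" for c
  proof -
    have "finite c" using that finite_subset by blast
    then show ?thesis by (auto simp: sum.remove[of c r] add.commute)
  qed
  have "fps_nth (?p c) r = fps_nth (?p c') r" using Suc.prems(3) by (simp add: fps_ideal_def)
  then have r: "r \<in> c \<longleftrightarrow> r \<in> c'" using top Suc.prems by (auto split: if_splits)
  then have "?p (c - {r}) - ?p (c' - {r}) = ?p c - ?p c'" using rem Suc.prems by auto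
  then have "?p (c - {r}) - ?p (c' - {r}) \<in> fps_ideal r"
    using Suc.prems(3) by (simp add: fps_ideal_def)
  then have "c - {r} = c' - {r}"
    using Suc.prems by (intro Suc.IH) (auto simp: less_Suc_eq)
  then show ?case using r by blast
qed auto

section \<open>Closed walks with central voltages\<close>

definition comm_walk :: "'a \<Rightarrow> 'a list \<Rightarrow> 'a list \<Rightarrow> 'a list" where
  "comm_walk v xs ys = xs @ ys @ back_walk v xs @ back_walk v ys"

text \<open>\<open>X\<close> and \<open>Z\<close> carry elementary unipotent voltages, and
  \<open>Y\<close> a diagonal unit whose powers spread them out. The walk in
  \<open>reduced_word\<close> is the later \<open>short_loop\<close>.\<close>

locale growth_graph = voltage_graph V adj A v0 \<phi>
  for V :: "'a set" and adj A v0 and \<phi> :: "'a \<Rightarrow> 'a \<Rightarrow> bit fps hall" +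
  fixes X Y Z :: "'a list"
  assumes X: "walk adj v0 X" "fin_vert v0 X = v0" "vol \<phi> v0 X = Hall 1 1 0 0"
    and Y: "walk adj v0 Y" "fin_vert v0 Y = v0" "vol \<phi> v0 Y = Hall (1 + fps_X) 0 0 0"
    and Z: "walk adj v0 Z" "fin_vert v0 Z = v0" "vol \<phi> v0 Z = Hall 1 0 1 0"
    and X_not_Nil: "X \<noteq> []"
    and reduced_word: "reduced (v0 # comm_walk v0 (comm_walk v0 X Y) (comm_walk v0 (back_walk v0 Y) Z)
      @ comm_walk v0 (comm_walk v0 X Y) (comm_walk v0 (back_walk v0 Y) Z))"
begin

definition loop :: "'a list \<Rightarrow> bool" where
  "loop xs \<longleftrightarrow> walk adj v0 xs \<and> fin_vert v0 xs = v0"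

lemma loop_Nil: "loop []" by (simp add: loop_def)

lemma loop_append: "loop xs \<Longrightarrow> loop ys \<Longrightarrow> loop (xs @ ys)"
  by (simp add: loop_def)

lemma loop_back_walk: "loop xs \<Longrightarrow> loop (back_walk v0 xs)"
  using walk_back_walk[of adj v0 xs] adj_sym fin_vert_back_walk[of v0 xs] by (auto simp: loop_def)

lemma loop_comm_walk: "loop xs \<Longrightarrow> loop ys \<Longrightarrow> loop (comm_walk v0 xs ys)"
  by (simp add: comm_walk_def loop_append loop_back_walk)

lemma loop_concat: "(\<And>xs. xs \<in> set l \<Longrightarrow> loop xs) \<Longrightarrow> loop (concat l)"
  by (induction l) (auto simp: loop_append loop_Nil)

lemma loops: "loop X" "loop Y" "loop Z"
  using X Y Z by (auto simp: loop_def)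

definition tvol :: "('a \<Rightarrow> 'a) \<Rightarrow> 'a list \<Rightarrow> bit fps hall" where
  "tvol a xs = vol \<phi> (a v0) (map a xs)"

lemma tvol_Nil: "tvol a [] = 1"
  by (simp add: tvol_def)

lemma tvol_append: "loop xs \<Longrightarrow> tvol a (xs @ ys) = tvol a xs * tvol a ys"
  by (simp add: tvol_def loop_def)

lemma tvol_back_walk:
  assumes "a \<in> A" "loop xs"
  shows "tvol a xs * tvol a (back_walk v0 xs) = 1" "tvol a (back_walk v0 xs) * tvol a xs = 1"
proof -
  have w: "walk adj (a v0) (map a xs)" using assms walk_map by (auto simp: loop_def)
  have f: "fin_vert (a v0) (map a xs) = a v0" using assms by (simp add: loop_def)
  show "tvol a xs * tvol a (back_walk v0 xs) = 1" "tvol a (back_walk v0 xs) * tvol a xs = 1"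
    using vol_back_walk[OF w] back_walk_vol[OF w] unfolding tvol_def f back_walk_map by auto
qed

lemma tvol_comm_walk:
  assumes "loop xs" "loop ys"
  shows "tvol a (comm_walk v0 xs ys) = tvol a xs * tvol a ys * tvol a (back_walk v0 xs) * tvol a (back_walk v0 ys)"
  unfolding comm_walk_def using assms by (simp add: tvol_append loop_append loop_back_walk mult.assoc)

lemma diag_tvol_comm_walk:
  assumes "a \<in> A" "loop xs" "loop ys"
  shows "diag (tvol a (comm_walk v0 xs ys)) = 1"
  unfolding tvol_comm_walk[OF assms(2,3)] using assms by (intro diag_commutator tvol_back_walk)

section \<open>Commutator words with central voltages\<close>

definition h1 :: "'a list" where "h1 = comm_walk v0 X Y"
text \<open>The reverse of \<open>Y\<close> comes first because \<open>h1\<close> ends with it: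
  starting with \<open>Y\<close> would make \<open>h1 @ h2\<close> backtrack.\<close>

definition h2 :: "'a list" where "h2 = comm_walk v0 (back_walk v0 Y) Z"
definition Y_power :: "nat \<Rightarrow> 'a list" where "Y_power i = concat (replicate i Y)"
definition h2_conj :: "nat \<Rightarrow> 'a list" where "h2_conj i = Y_power i @ h2 @ back_walk v0 (Y_power i)"

lemma loops': "loop h1" "loop h2" "loop (Y_power i)" "loop (h2_conj i)"
proof -
  show "loop h1" "loop h2" by (simp_all add: h1_def h2_def loops loop_comm_walk loop_back_walk)
  moreover show "loop (Y_power i)" unfolding Y_power_def by (rule loop_concat) (auto simp: loops)
  ultimately show "loop (h2_conj i)" by (simp add: h2_conj_def loop_append loop_back_walk)
qed

text \<open>Commutators and their conjugates have diagonal entry one under every \<open>a\<close>,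
  whatever the voltages of the translated walks are.\<close>

lemma diag_h: "a \<in> A \<Longrightarrow> diag (tvol a h1) = 1" "a \<in> A \<Longrightarrow> diag (tvol a h2) = 1" "a \<in> A \<Longrightarrow> diag (tvol a (h2_conj i)) = 1"
proof -
  show "diag (tvol a h1) = 1" and h2: "diag (tvol a h2) = 1" if "a \<in> A"
    using that by (simp_all add: h1_def h2_def diag_tvol_comm_walk loops loop_back_walk)
  assume a: "a \<in> A"
  have "diag (tvol a (Y_power i)) * diag (tvol a (back_walk v0 (Y_power i))) = 1"
    by (rule hall_inverse(1)[OF tvol_back_walk(1)[OF a loops'(3)]])
  then show "diag (tvol a (h2_conj i)) = 1"
    using h2[OF a] by (simp add: h2_conj_def tvol_append loops' times_hall_def)
qed

text \<open>By \<open>hall_commutator\<close> its voltage is central for every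
  \<open>a \<in> A\<close>. For the identity, conjugating \<open>h2\<close> by the
  \<open>i\<close>-th power of \<open>Y\<close> brings in the factor
  \<open>(1 + fps_X) ^ i\<close>.\<close>

definition word :: "nat \<Rightarrow> 'a list" where
  "word i = comm_walk v0 h1 (h2_conj i)"

definition weight :: "('a \<Rightarrow> 'a) \<Rightarrow> nat \<Rightarrow> bit fps" where
  "weight a i = upper (tvol a h1) * right (tvol a (h2_conj i)) - upper (tvol a (h2_conj i)) * right (tvol a h1)"

lemma tvol_word: "a \<in> A \<Longrightarrow> tvol a (word i) = Hall 1 0 0 (weight a i)"
  unfolding word_def weight_def
  by (subst tvol_comm_walk) (auto intro!: hall_commutator tvol_back_walk loops' diag_h)

text \<open>Central voltages multiply in any order; sorting merely fixes one concatenation.\<close>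

definition set_word :: "nat set \<Rightarrow> 'a list" where
  "set_word c = concat (map word (sorted_list_of_set c))"

lemma loop_word: "loop (word i)"
  by (simp add: word_def loop_comm_walk loops')

lemma loop_set_word: "loop (set_word c)"
  unfolding set_word_def by (rule loop_concat) (auto simp: loop_word)

lemma tvol_set_word:
  assumes "a \<in> A" "finite c"
  shows "tvol a (set_word c) = Hall 1 0 0 (\<Sum>i\<in>c. weight a i)"
proof -
  have "tvol a (concat (map word l)) = Hall 1 0 0 (sum_list (map (weight a) l))" for l
    by (induction l) (auto simp: tvol_Nil one_hall_def tvol_append loop_word tvol_word assms Hall_center_mult)
  then show ?thesis using assms(2) unfolding set_word_def
    by (simp add: sum_list_distinct_conv_sum_set)
qed

text \<open>With \<open>u = 1 + fps_X\<close> and its inverse \<open>u'\<close>, the weight is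
  \<open>(1 - u') * u ^ i * (u' - 1)\<close>; multiplying by \<open>u\<^sup>2\<close> clears the
  inverses.\<close>

lemma weight_eq:
  assumes a: "a \<in> A"
    and t: "tvol a X = Hall 1 1 0 0" "tvol a Y = Hall (1 + fps_X) 0 0 0" "tvol a Z = Hall 1 0 1 0"
  shows "(1 + fps_X)\<^sup>2 * weight a i = - (fps_X\<^sup>2) * (1 + fps_X) ^ i"
proof -
  let ?u = "1 + fps_X :: bit fps"
  \<comment> \<open>Inverses in a monoid are unique, so a right inverse of the voltage is the
    voltage of the reversed walk.\<close>
  have inv: "tvol a (back_walk v0 xs) = z" if "loop xs" "tvol a xs * z = 1" for xs z
  proof -
    have "z = (tvol a (back_walk v0 xs) * tvol a xs) * z"
      using tvol_back_walk(2)[OF a that(1)] by simp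
    then show ?thesis unfolding mult.assoc that(2) by simp
  qed
  define u' where "u' = diag (tvol a (back_walk v0 Y))"
  have u': "?u * u' = 1"
    using hall_inverse(1)[OF tvol_back_walk(1)[OF a loops(2)]] t(2) by (simp add: u'_def)
  have t': "tvol a (back_walk v0 X) = Hall 1 (-1) 0 0" "tvol a (back_walk v0 Y) = Hall u' 0 0 0"
    "tvol a (back_walk v0 Z) = Hall 1 0 (-1) 0"
    by (rule inv; simp add: loops t u' hall_simps)+
  have Yp: "tvol a (Y_power i) = Hall (?u ^ i) 0 0 0"
    by (induction i) (auto simp: Y_power_def tvol_Nil tvol_append loops t hall_simps)
  have Yp': "tvol a (back_walk v0 (Y_power i)) = Hall (u' ^ i) 0 0 0"
    using u' by (intro inv) (simp_all add: loops' Yp hall_simps flip: power_mult_distrib)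
  have Y'': "back_walk v0 (back_walk v0 Y) = Y"
    using back_walk_back_walk[of v0 Y] Y(2) by simp
  have "tvol a h1 = Hall 1 (1 - u') 0 0"
    unfolding h1_def tvol_comm_walk[OF loops(1,2)] t t' using u'
    by (simp add: hall_simps algebra_simps)
  moreover have "tvol a h2 = Hall 1 0 (u' - 1) 0"
    unfolding h2_def tvol_comm_walk[OF loop_back_walk[OF loops(2)] loops(3)] Y'' t t' using u'
    by (simp add: hall_simps algebra_simps)
  then have "tvol a (h2_conj i) = Hall 1 0 (?u ^ i * (u' - 1)) 0"
    unfolding h2_conj_def using u'
    by (simp add: tvol_append loops' Yp Yp' hall_simps flip: power_mult_distrib)
  moreover have factor: "x\<^sup>2 * ((1 - y) * (p * (y - 1))) = (x - x * y) * (x * y - x) * p" for x y p :: "bit fps"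
    by (simp add: power2_eq_square algebra_simps)
  ultimately have w: "weight a i = (1 - u') * (?u ^ i * (u' - 1))"
    by (simp add: weight_def)
  have "?u\<^sup>2 * weight a i = (?u - ?u * u') * (?u * u' - ?u) * ?u ^ i"
    unfolding w by (rule factor)
  then show ?thesis unfolding u' by (simp add: power2_eq_square algebra_simps)
qed

lemma weight_id: "(1 + fps_X)\<^sup>2 * weight id i = - (fps_X\<^sup>2) * (1 + fps_X) ^ i"
  by (rule weight_eq[OF A_id]) (use X Y Z in \<open>simp_all add: tvol_def\<close>)

text \<open>Up to a unit the weights are \<open>fps_X\<^sup>2\<close> times powers of
  \<open>1 + fps_X\<close>. Cancelling the square costs two coefficients, whence
  \<open>r + 2\<close>.\<close>

lemma weights_independent:
  assumes "c \<subseteq> {..<r}" "c' \<subseteq> {..<r}"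
    and "(\<Sum>i\<in>c. weight id i) - (\<Sum>i\<in>c'. weight id i) \<in> fps_ideal (r + 2)"
  shows "c = c'"
proof -
  let ?p = "\<lambda>c. \<Sum>i\<in>c. (1 + fps_X :: bit fps) ^ i"
  have "(1 + fps_X)\<^sup>2 * (\<Sum>i\<in>c. weight id i) = - (fps_X\<^sup>2) * ?p c" for c
    unfolding sum_distrib_left weight_id ..
  then have "((\<Sum>i\<in>c. weight id i) - (\<Sum>i\<in>c'. weight id i)) * (1 + fps_X)\<^sup>2 = - (fps_X\<^sup>2 * (?p c - ?p c'))"
    by (simp add: algebra_simps)
  then have "- (fps_X\<^sup>2 * (?p c - ?p c')) \<in> fps_ideal (r + 2)"
    using fps_ideal_mult[OF assms(3), of "(1 + fps_X)\<^sup>2"] by simp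
  then have "fps_nth (fps_X\<^sup>2 * (?p c - ?p c')) (n + 2) = 0" if "n < r" for n
    using that by (simp add: fps_ideal_def)
  then have "?p c - ?p c' \<in> fps_ideal r"
    by (simp add: fps_ideal_def fps_X_power_mult_nth)
  then show ?thesis using assms one_plus_X_powers_independent by blast
qed

text \<open>The commutator of \<open>h1\<close> and \<open>h2\<close> has a central voltage, whose
  square is trivial in characteristic two. Its square thus has a closed lift in every cover
  constructed below, of a length independent of the cover.\<close>

definition short_loop :: "'a list" where
  "short_loop = comm_walk v0 h1 h2 @ comm_walk v0 h1 h2"

lemma short_loop: "loop short_loop" "reduced (v0 # short_loop)" "length short_loop > 1"
    "a \<in> A \<Longrightarrow> tvol a short_loop = 1"
proof -
  show "loop short_loop" by (simp add: short_loop_def loop_append loop_comm_walk loops')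
  show "reduced (v0 # short_loop)" using reduced_word by (simp add: short_loop_def h1_def h2_def)
  show "length short_loop > 1"
    using X_not_Nil[folded length_greater_0_conv]
    unfolding short_loop_def h1_def comm_walk_def length_append by linarith
  assume a: "a \<in> A"
  then obtain z where "tvol a (comm_walk v0 h1 h2) = Hall 1 0 0 z"
    using hall_commutator[OF tvol_back_walk(1)[OF a loops'(1)] tvol_back_walk(1)[OF a loops'(2)]] diag_h
    by (simp add: tvol_comm_walk loops')
  then show "tvol a short_loop = 1"
    by (simp add: short_loop_def tvol_append loop_comm_walk loops' Hall_center_mult fps_bit_add_self one_hall_def)
qed

end

section \<open>Counting isomorphism classes\<close>

abbreviation iso_rel :: "nat \<Rightarrow> nat pair_pre_digraph rel" where
  "iso_rel n \<equiv> {(G, H). G \<in> cubic_5_arc_transitive_graphs n \<and> H \<in> cubic_5_arc_transitive_graphs n \<and>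
    digraph_iso (with_proj G) (with_proj H)}"

lemma cubic_5_arc_transitive_graphsD:
  assumes "G \<in> cubic_5_arc_transitive_graphs n"
  shows "pair_wf_digraph G" "finite (pverts G)" "card (pverts G) \<le> n"
proof -
  interpret pair_graph G using assms by (simp add: cubic_5_arc_transitive_graphs_def)
  show "pair_wf_digraph G" "finite (pverts G)" by (rule pair_wf_digraph, rule pair_finite_verts)
  show "card (pverts G) \<le> n" using assms by (simp add: cubic_5_arc_transitive_graphs_def)
qed

lemma iso_rel_iff:
  assumes "G \<in> cubic_5_arc_transitive_graphs n"
  shows "(G, H) \<in> iso_rel n \<longleftrightarrow> H \<in> cubic_5_arc_transitive_graphs n \<and> (\<exists>f. vert_iso G H f)"
  using assms digraph_iso_iff_vert_iso cubic_5_arc_transitive_graphsD(1) by auto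

lemma iso_rel_class_eq:
  assumes G: "G \<in> cubic_5_arc_transitive_graphs n" "vert_iso G K f" and H: "H \<in> cubic_5_arc_transitive_graphs n" "vert_iso H K g"
  shows "iso_rel n `` {G} = iso_rel n `` {H}"
proof -
  have sub: "iso_rel n `` {G} \<subseteq> iso_rel n `` {H}"
    if G: "G \<in> cubic_5_arc_transitive_graphs n" "vert_iso G K f" and H: "H \<in> cubic_5_arc_transitive_graphs n" "vert_iso H K g"
    for G H f g
  proof
    fix M assume "M \<in> iso_rel n `` {G}"
    then obtain h where M: "M \<in> cubic_5_arc_transitive_graphs n" "vert_iso G M h"
      unfolding Image_singleton_iff iso_rel_iff[OF G(1)] by blast
    have "vert_iso H M (h \<circ> inv_into (pverts G) f \<circ> g)"
      using vert_iso_comp[OF H(2) vert_iso_comp[OF vert_iso_inv[OF G(2)] M(2)]] by (simp add: comp_assoc)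
    then show "M \<in> iso_rel n `` {H}" unfolding Image_singleton_iff iso_rel_iff[OF H(1)] using M(1) by blast
  qed
  show ?thesis using sub[OF G H] sub[OF H G] by blast
qed

lemma isomorphism_classes_eq:
  "isomorphism_classes (cubic_5_arc_transitive_graphs n) = (\<lambda>G. iso_rel n `` {G}) ` cubic_5_arc_transitive_graphs n"
  unfolding isomorphism_classes_def quotient_def by auto

text \<open>An infinite set would have \<open>card\<close> 0, so finiteness has to be established;
  relabelling vertices by an initial segment of the natural numbers leaves finitely many
  representatives.\<close>

lemma finite_isomorphism_classes: "finite (isomorphism_classes (cubic_5_arc_transitive_graphs n))"
proof -
  let ?P = "(\<lambda>(V, E). \<lparr>pverts = V, parcs = E\<rparr>) ` (Pow {..<n} \<times> Pow ({..<n} \<times> {..<n}))"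
  have "\<exists>H \<in> ?P. \<exists>f. vert_iso G H f" if G: "G \<in> cubic_5_arc_transitive_graphs n" for G
  proof -
    interpret pair_wf_digraph G by (rule cubic_5_arc_transitive_graphsD[OF G])
    obtain f where f: "bij_betw f (pverts G) {0..<card (pverts G)}"
      using ex_bij_betw_finite_nat[OF cubic_5_arc_transitive_graphsD(2)[OF G]] by blast
    have f_lt: "f v < n" if "v \<in> pverts G" for v
    proof -
      have "f v \<in> {0..<card (pverts G)}" using bij_betwE[OF f] that by blast
      then show ?thesis using cubic_5_arc_transitive_graphsD(3)[OF G] by simp
    qed
    let ?H = "\<lparr>pverts = {0..<card (pverts G)}, parcs = map_prod f f ` parcs G\<rparr>"
    have "{0..<card (pverts G)} \<subseteq> {..<n}"
      using cubic_5_arc_transitive_graphsD(3)[OF G] by auto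
    moreover have "map_prod f f ` parcs G \<subseteq> {..<n} \<times> {..<n}"
      using f_lt by (auto dest: in_arcsD1 in_arcsD2)
    ultimately have "?H \<in> ?P"
      by (intro image_eqI[of _ _ "({0..<card (pverts G)}, map_prod f f ` parcs G)"]) auto
    moreover have "vert_iso G ?H f"
      unfolding vert_iso_def
    proof (intro conjI ballI)
      fix u v assume uv: "u \<in> pverts G" "v \<in> pverts G"
      show "(u, v) \<in> parcs G \<longleftrightarrow> (f u, f v) \<in> parcs ?H"
      proof
        assume "(f u, f v) \<in> parcs ?H"
        then obtain x y where "(x, y) \<in> parcs G" "f x = f u" "f y = f v" by auto
        moreover from this have "x \<in> pverts G" "y \<in> pverts G" by (auto dest: in_arcsD1 in_arcsD2)
        ultimately show "(u, v) \<in> parcs G" using f uv unfolding bij_betw_def by (auto dest: inj_onD)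
      qed force
    qed (use f in simp)
    ultimately show ?thesis by blast
  qed
  then obtain \<tau> where \<tau>: "\<And>G. G \<in> cubic_5_arc_transitive_graphs n \<Longrightarrow> \<tau> G \<in> ?P"
    "\<And>G. G \<in> cubic_5_arc_transitive_graphs n \<Longrightarrow> \<exists>f. vert_iso G (\<tau> G) f"
    unfolding Bex_def by (metis (no_types, lifting))
  show ?thesis
    unfolding isomorphism_classes_eq
  proof (rule card_image_le_if_factors)
    have "\<tau> ` cubic_5_arc_transitive_graphs n \<subseteq> ?P" using \<tau>(1) by blast
    then show "finite (\<tau> ` cubic_5_arc_transitive_graphs n)" by (rule finite_subset) simp
  next
    fix G H assume GH: "G \<in> cubic_5_arc_transitive_graphs n" "H \<in> cubic_5_arc_transitive_graphs n" "\<tau> G = \<tau> H"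
    obtain f g where "vert_iso G (\<tau> G) f" "vert_iso H (\<tau> G) g"
      using \<tau>(2)[OF GH(1)] \<tau>(2)[OF GH(2)] unfolding GH(3) by blast
    then show "iso_rel n `` {G} = iso_rel n `` {H}"
      using iso_rel_class_eq GH by blast
  qed
qed

lemma card_image_le_fibres:
  assumes "finite S" "\<And>x. x \<in> S \<Longrightarrow> card (g ` {y \<in> S. f y = f x}) \<le> k"
  shows "card (g ` S) \<le> card (f ` S) * k"
proof -
  have "g ` S = (\<Union>z \<in> f ` S. g ` {y \<in> S. f y = z})" by auto
  then have "card (g ` S) \<le> (\<Sum>z \<in> f ` S. card (g ` {y \<in> S. f y = z}))"
    using card_UN_le[of "f ` S" "\<lambda>z. g ` {y \<in> S. f y = z}"] assms(1) by simp
  also have "\<dots> \<le> (\<Sum>z \<in> f ` S. k)" using assms(2) by (intro sum_mono) auto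
  finally show ?thesis by simp
qed

section \<open>Covers indexed by tuples of subsets\<close>

context growth_graph
begin

lemma card_A_pos: "card A > 0"
  using finite_A A_id by (auto simp: card_gt_0_iff)

text \<open>The number of words available. The factor 2 makes the number of tuples the square of the
  bound on how many of them share the same \<open>trivial_sets\<close>.\<close>

definition rank :: "nat \<Rightarrow> nat" where "rank d = 2 * card A * d"

definition tuples :: "nat \<Rightarrow> (nat \<Rightarrow> nat set) set" where
  "tuples d = {..<d} \<rightarrow>\<^sub>E Pow {..<rank d}"

text \<open>All translates by \<open>A\<close> are included, because a lift is closed only if the
  voltages of all translates are trivial modulo the congruence.\<close>

definition span :: "nat \<Rightarrow> (nat \<Rightarrow> nat set) \<Rightarrow> bit fps set" where
  "span d u = subset_sums (\<lambda>(a, j). \<Sum>i\<in>u j. weight a i) (A \<times> {..<d}) (fps_ideal (rank d + 2))"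

text \<open>These are the \<open>c\<close> for which \<open>set_word c\<close> has a closed lift in
  the cover defined by \<open>u\<close>.\<close>

definition trivial_sets :: "nat \<Rightarrow> (nat \<Rightarrow> nat set) \<Rightarrow> nat set set" where
  "trivial_sets d u = {c. c \<subseteq> {..<rank d} \<and> (\<forall>a \<in> A. (\<Sum>i\<in>c. weight a i) \<in> span d u)}"

lemma finite_tuples: "finite (tuples d)" and card_tuples: "card (tuples d) = 2 ^ (rank d * d)"
  by (simp_all add: tuples_def finite_PiE card_PiE card_Pow power_mult)

lemma finite_trivial_sets: "finite (trivial_sets d u)"
  by (rule finite_subset[of _ "Pow {..<rank d}"]) (auto simp: trivial_sets_def)

text \<open>Modulo the ideal the span has \<open>card A * d\<close> generators, and by
  \<open>weights_independent\<close> a set is determined by the residue of its weight sum for the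
  identity.\<close>

lemma card_trivial_sets_le: "card (trivial_sets d u) \<le> 2 ^ (card A * d)"
proof -
  let ?g = "\<lambda>(a, j). \<Sum>i\<in>u j. weight a i" and ?S = "A \<times> {..<d}" and ?I = "fps_ideal (rank d + 2) :: bit fps set"
  have "\<exists>s. s \<subseteq> ?S \<and> (\<Sum>i\<in>c. weight id i) - sum ?g s \<in> ?I" if "c \<in> trivial_sets d u" for c
  proof -
    have "(\<Sum>i\<in>c. weight id i) \<in> span d u" using that A_id by (auto simp: trivial_sets_def)
    then obtain s i where "s \<subseteq> ?S" "i \<in> ?I" "(\<Sum>i\<in>c. weight id i) = sum ?g s + i"
      unfolding span_def subset_sums_def by blast
    then show ?thesis by (intro exI[of _ s]) simp
  qed
  then obtain \<sigma> where \<sigma>: "\<And>c. c \<in> trivial_sets d u \<Longrightarrow> \<sigma> c \<subseteq> ?S"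
    "\<And>c. c \<in> trivial_sets d u \<Longrightarrow> (\<Sum>i\<in>c. weight id i) - sum ?g (\<sigma> c) \<in> ?I"
    by metis
  have "inj_on \<sigma> (trivial_sets d u)"
  proof
    fix c c' assume c: "c \<in> trivial_sets d u" "c' \<in> trivial_sets d u" "\<sigma> c = \<sigma> c'"
    have "(\<Sum>i\<in>c. weight id i) - (\<Sum>i\<in>c'. weight id i) \<in> ?I"
      using add_subgroupD(2)[OF add_subgroup_fps_ideal \<sigma>(2)[OF c(1)] \<sigma>(2)[OF c(2)]] c(3) by simp
    then show "c = c'" using c by (intro weights_independent) (auto simp: trivial_sets_def)
  qed
  then have "card (trivial_sets d u) \<le> card (Pow ?S)"
    using \<sigma>(1) finite_A by (intro card_inj_on_le[of \<sigma>]) auto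
  then show ?thesis using finite_A by (simp add: card_Pow card_cartesian_product)
qed

lemma tuple_in_trivial_sets:
  assumes "u \<in> tuples d"
  shows "u \<in> {..<d} \<rightarrow>\<^sub>E trivial_sets d u"
proof -
  have "u j \<in> trivial_sets d u" if "j < d" for j
  proof -
    have "(\<Sum>i\<in>u j. weight a i) \<in> span d u" if "a \<in> A" for a
      using subset_sums_member[OF add_subgroup_fps_ideal, of "(a, j)" "A \<times> {..<d}" "\<lambda>(a, j). \<Sum>i\<in>u j. weight a i"]
        that \<open>j < d\<close> unfolding span_def by simp
    then show ?thesis using that assms by (auto simp: trivial_sets_def tuples_def)
  qed
  then show ?thesis using assms by (auto simp: tuples_def)
qed

text \<open>The entries of \<open>u\<close> are themselves trivial sets, so a given value of
  \<open>trivial_sets\<close> comes from at most \<open>(2 ^ (card A * d)) ^ d\<close> tuples, which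
  is the square root of the number of all tuples.\<close>

lemma card_trivial_sets_image: "2 ^ (card A * d * d) \<le> card (trivial_sets d ` tuples d)"
proof -
  have "card {v \<in> tuples d. trivial_sets d v = trivial_sets d u} \<le> 2 ^ (card A * d * d)" for u
  proof -
    have "{v \<in> tuples d. trivial_sets d v = trivial_sets d u} \<subseteq> {..<d} \<rightarrow>\<^sub>E trivial_sets d u"
      using tuple_in_trivial_sets by blast
    then have "card {v \<in> tuples d. trivial_sets d v = trivial_sets d u} \<le> card ({..<d} \<rightarrow>\<^sub>E trivial_sets d u)"
      by (intro card_mono) (simp_all add: finite_PiE finite_trivial_sets)
    also have "\<dots> = card (trivial_sets d u) ^ d" by (simp add: card_PiE)
    also have "\<dots> \<le> (2 ^ (card A * d)) ^ d" by (intro power_mono card_trivial_sets_le) simp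
    finally show ?thesis by (simp add: power_mult)
  qed
  then have "card (tuples d) \<le> card (trivial_sets d ` tuples d) * 2 ^ (card A * d * d)"
    using card_image_le_fibres[where S = "tuples d" and g = "\<lambda>u. u" and f = "trivial_sets d"
        and k = "2 ^ (card A * d * d)"] finite_tuples by simp
  moreover have "card (tuples d) = 2 ^ (card A * d * d) * 2 ^ (card A * d * d)"
    by (simp add: card_tuples rank_def flip: power_add)
  ultimately show ?thesis by simp
qed

abbreviation "order_bound d \<equiv> card V * (2 ^ (4 * (rank d + 2))) ^ card A"

text \<open>The congruence uses the span in the corner and the ideal elsewhere, so a set word has a
  closed lift when all its corners lie in the span. A vertex is described by an endpoint and, for
  each element of \<open>A\<close>, four truncated series of \<open>rank d + 2\<close> bits.\<close>

lemma ex_tuple_cover: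
  obtains st :: "'a list \<Rightarrow> nat" where "regular_cover V adj A v0 st"
    and "\<And>c. c \<subseteq> {..<rank d} \<Longrightarrow> st (set_word c) = st [] \<longleftrightarrow> c \<in> trivial_sets d u"
    and "st short_loop = st []" and "card (st ` walks) \<le> order_bound d"
proof -
  let ?I = "fps_ideal (rank d + 2) :: bit fps set" and ?W = "span d u"
  have W: "add_subgroup ?W" "?I \<subseteq> ?W"
    unfolding span_def using finite_A fps_bit_add_self
    by (auto intro!: add_subgroup_subset_sums add_subgroup_fps_ideal subset_sums_superset)
  obtain st :: "'a list \<Rightarrow> nat" where st: "regular_cover V adj A v0 st"
    "\<And>xs ys. walk adj v0 xs \<Longrightarrow> walk adj v0 ys \<Longrightarrow> st xs = st ys \<longleftrightarrow> walk_cong (hall_cong ?I ?W) xs ys"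
    "card (st ` walks) \<le> order_bound d"
  proof (rule ex_regular_cover[of "hall_cong ?I ?W" "hall_trunc (rank d + 2)" "hall_truncs (rank d + 2)"])
    show "equivp (hall_cong ?I ?W)" by (rule equivp_hall_cong[OF add_subgroup_fps_ideal W(1)])
    show "hall_cong ?I ?W (x * y) (x' * y')" if "hall_cong ?I ?W x x'" "hall_cong ?I ?W y y'" for x x' y y'
      by (rule hall_cong_mult[OF add_subgroup_fps_ideal fps_ideal_mult W that])
    show "hall_cong ?I ?W x y" if "hall_trunc (rank d + 2) x = hall_trunc (rank d + 2) y" for x y
      by (rule hall_trunc_eqD[OF that W(2)])
  qed (use hall_truncs in \<open>auto simp: hall_truncs(3)\<close>)
  have closed: "st xs = st [] \<longleftrightarrow> (\<forall>a \<in> A. hall_cong ?I ?W (tvol a xs) 1)" if "loop xs" for xs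
    using st(2)[of xs "[]"] that by (simp add: walk_cong_def loop_def tvol_def)
  show thesis
  proof (rule that[OF st(1) _ _ st(3)])
    fix c assume c: "c \<subseteq> {..<rank d}"
    then have "finite c" using finite_subset by blast
    then show "st (set_word c) = st [] \<longleftrightarrow> c \<in> trivial_sets d u"
      unfolding closed[OF loop_set_word] using c
      by (simp add: tvol_set_word hall_cong_def one_hall_def trivial_sets_def add_subgroupD(1)[OF add_subgroup_fps_ideal])
  next
    show "st short_loop = st []"
      unfolding closed[OF short_loop(1)]
      using short_loop(4) equivp_reflp[OF equivp_hall_cong[OF add_subgroup_fps_ideal W(1)]] by simp
  qed
qed

end

section \<open>Few covers are isomorphic to a given graph\<close>

lemma (in regular_cover) cover_1_arc_transitive: "s_arc_transitive 1 (with_proj cover)"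
proof -
  interpret cubic_graph cover by (rule cover_cubic_graph)
  have "s_arc_transitive (Suc (Suc (Suc (Suc (Suc 0))))) (with_proj cover)"
    using cover_5_arc_transitive by (simp add: numeral_eq_Suc)
  from s_arc_transitive_mono[OF s_arc_transitive_mono[OF s_arc_transitive_mono[OF s_arc_transitive_mono[OF this]]]]
  show ?thesis by simp
qed

text \<open>An isomorphism from a cover to \<open>G\<close> transports the base point and the lifts of
  \<open>covers_agree\<close> to \<open>G\<close>, where only polynomially many choices are available for them.\<close>

lemma (in base_graph) card_covers_of_graph_le:
  fixes st :: "'u \<Rightarrow> 'a list \<Rightarrow> 'v" and G :: "'w pair_pre_digraph"
  assumes G: "cubic_graph G" "s_arc_transitive 1 (with_proj G)"
    and p: "s_arc (with_proj G) l p" "p ! 0 = p ! l" "l > 1"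
    and st: "\<And>u. u \<in> D \<Longrightarrow> regular_cover V adj A v0 (st u)"
    and f: "\<And>u. u \<in> D \<Longrightarrow> vert_iso (regular_cover.cover adj v0 (st u)) G (f u)"
    and \<kappa>: "\<And>u u'. \<lbrakk>u \<in> D; u' \<in> D; \<And>xs ys. walk adj v0 xs \<Longrightarrow> walk adj v0 ys \<Longrightarrow>
      st u xs = st u ys \<longleftrightarrow> st u' xs = st u' ys\<rbrakk> \<Longrightarrow> \<kappa> u = \<kappa> u'"
  shows "card (\<kappa> ` D) \<le> card (pverts G) ^ (3 * l + 1)"
proof -
  interpret G: cubic_graph G by fact
  let ?cov = "\<lambda>u. regular_cover.cover adj v0 (st u)" and ?lift = "\<lambda>u. regular_cover.lift adj v0 (st u)"
  let ?N = "{x. adj v0 x}" and ?Aut = "{h \<in> extensional (pverts G). vert_iso G G h}"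
  have "\<exists>a. a \<in> A \<and> a v0 = x" if "adj v0 x" for x using A_vertices[of x] adj_V[OF adj_sym[OF that]] by blast
  then obtain a where a: "\<And>x. adj v0 x \<Longrightarrow> a x \<in> A \<and> a x v0 = x" by metis
  \<comment> \<open>\<open>h u x\<close> is the lift of \<open>a x\<close> transported along
    \<open>f u\<close> to an automorphism of \<open>G\<close>.\<close>
  define h where "h u x = f u \<circ> ?lift u (a x) [x] \<circ> inv_into (pverts (?cov u)) (f u)" for u x
  \<comment> \<open>There are \<open>card (pverts G)\<close> choices for the base point and at most
    the \<open>l\<close>-th power of this for each of three automorphisms, whence the exponent
    \<open>3 * l + 1\<close>. Restriction places the maps in a finite set.\<close>
  define data where "data u = (f u (st u []), \<lambda>x \<in> ?N. restrict (h u x) (pverts G))" for u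
  have pverts: "pverts (?cov u) = st u ` walks" if "u \<in> D" for u
    using regular_cover.cover_simps[OF st[OF that]] .
  have mem: "f u (st u xs) \<in> pverts G" if "u \<in> D" "walk adj v0 xs" for u xs
    using vert_iso_mem[OF f[OF that(1)], of "st u xs"] pverts[OF that(1)] that(2) by auto
  have h: "vert_iso G G (h u x)" if "u \<in> D" "adj v0 x" for u x
  proof -
    have "vert_iso (?cov u) (?cov u) (?lift u (a x) [x])"
      using a[OF that(2)] that(2) by (intro regular_cover.vert_iso_lift[OF st[OF that(1)]]) auto
    then show ?thesis unfolding h_def
      by (intro vert_iso_comp[OF vert_iso_inv[OF f[OF that(1)]]] vert_iso_comp[OF _ f[OF that(1)]])
  qed
  have h_eq: "f u (?lift u (a x) [x] (st u xs)) = h u x (f u (st u xs))" if "u \<in> D" "walk adj v0 xs" for u x xs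
  proof -
    have "inv_into (pverts (?cov u)) (f u) (f u (st u xs)) = st u xs"
      using f[OF that(1)] pverts[OF that(1)] that(2) by (intro inv_into_f_f) (auto simp: vert_iso_def bij_betw_def)
    then show ?thesis by (simp add: h_def)
  qed
  have fin: "finite (pverts G \<times> (?N \<rightarrow>\<^sub>E ?Aut))"
    and card: "card (pverts G \<times> (?N \<rightarrow>\<^sub>E ?Aut)) \<le> card (pverts G) ^ (3 * l + 1)"
  proof -
    have N: "card ?N = 3" using degree[OF v0] .
    then have "finite ?N" by (metis card.infinite zero_neq_numeral)
    note Aut = G.card_automorphisms_le[OF G(2) p]
    show "finite (pverts G \<times> (?N \<rightarrow>\<^sub>E ?Aut))"
      using \<open>finite ?N\<close> Aut(1) G.pair_finite_verts by (intro finite_cartesian_product finite_PiE)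
    have "card (pverts G \<times> (?N \<rightarrow>\<^sub>E ?Aut)) = card (pverts G) * card ?Aut ^ 3"
      using \<open>finite ?N\<close> N by (simp add: card_cartesian_product card_PiE)
    also have "\<dots> \<le> card (pverts G) * (card (pverts G) ^ l) ^ 3"
      by (intro mult_left_mono power_mono Aut) auto
    finally show "card (pverts G \<times> (?N \<rightarrow>\<^sub>E ?Aut)) \<le> card (pverts G) ^ (3 * l + 1)"
      by (simp add: power_mult mult.commute)
  qed
  have "vert_iso G G (restrict (h u x) (pverts G))" if "u \<in> D" "adj v0 x" for u x
    by (rule vert_iso_cong[OF h[OF that]]) simp
  then have sub: "data ` D \<subseteq> pverts G \<times> (?N \<rightarrow>\<^sub>E ?Aut)"
    using mem[of _ "[]"] by (auto simp: data_def)
  have "\<kappa> u = \<kappa> u'" if u: "u \<in> D" "u' \<in> D" and eq: "data u = data u'" for u u'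
  proof -
    have base: "f u (st u []) = f u' (st u' [])" using eq by (simp add: data_def)
    have hh: "h u x y = h u' x y" if "adj v0 x" "y \<in> pverts G" for x y
    proof -
      have "(\<lambda>x \<in> ?N. restrict (h u x) (pverts G)) x = (\<lambda>x \<in> ?N. restrict (h u' x) (pverts G)) x"
        using eq unfolding data_def by simp
      then have "restrict (h u x) (pverts G) y = restrict (h u' x) (pverts G) y" using that(1) by simp
      then show ?thesis using that(2) by simp
    qed
    have *: "f u (st u xs) = f u' (st u' xs)" if "walk adj v0 xs" for xs
    proof (rule covers_agree[where a = a and f = "f u" and f' = "f u'" and h = "h u",
          OF st[OF u(1)] st[OF u(2)] a base _ _ that])
      show "f u (?lift u (a x) [x] (st u ys)) = h u x (f u (st u ys))" if "walk adj v0 ys" for x ys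
        by (rule h_eq[OF u(1) that])
      show "f u' (?lift u' (a x) [x] (st u' ys)) = h u x (f u' (st u' ys))" if "adj v0 x" "walk adj v0 ys" for x ys
        using h_eq[OF u(2) that(2)] hh[OF that(1) mem[OF u(2) that(2)]] by (rule trans[OF _ sym])
    qed
    have inj: "f w (st w xs) = f w (st w ys) \<longleftrightarrow> st w xs = st w ys"
      if "w \<in> D" "walk adj v0 xs" "walk adj v0 ys" for w xs ys
      using that(2,3) by (intro vert_iso_inj[OF f[OF that(1)]]) (auto simp: pverts[OF that(1)])
    show ?thesis
    proof (rule \<kappa>[OF u])
      fix xs ys assume w: "walk adj v0 xs" "walk adj v0 ys"
      show "st u xs = st u ys \<longleftrightarrow> st u' xs = st u' ys"
        unfolding inj[OF u(1) w, symmetric] inj[OF u(2) w, symmetric] *[OF w(1)] *[OF w(2)] ..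
    qed
  qed
  then have "card (\<kappa> ` D) \<le> card (data ` D)"
    by (rule card_image_le_if_factors(2)[OF _ finite_subset[OF sub fin]])
  also have "\<dots> \<le> card (pverts G \<times> (?N \<rightarrow>\<^sub>E ?Aut))" using sub fin by (rule card_mono[rotated])
  finally show ?thesis using card by (rule order_trans)
qed

text \<open>By \<open>card_trivial_sets_image\<close> the covers realise many values of
  \<open>trivial_sets\<close>, while by \<open>card_covers_of_graph_le\<close> those in one
  isomorphism class realise only few.\<close>

lemma (in growth_graph) card_isomorphism_classes_ge:
  assumes n: "order_bound d \<le> n"
  shows "2 ^ (card A * d * d) \<le>
    card (isomorphism_classes (cubic_5_arc_transitive_graphs n)) * order_bound d ^ (3 * length short_loop + 1)"
proof -
  have "\<exists>st :: 'a list \<Rightarrow> nat. regular_cover V adj A v0 st \<and>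
      (\<forall>c. c \<subseteq> {..<rank d} \<longrightarrow> (st (set_word c) = st [] \<longleftrightarrow> c \<in> trivial_sets d u)) \<and>
      st short_loop = st [] \<and> card (st ` walks) \<le> order_bound d" for u
    by (rule ex_tuple_cover[of d u]) blast
  then obtain st :: "(nat \<Rightarrow> nat set) \<Rightarrow> 'a list \<Rightarrow> nat" where st: "\<And>u. regular_cover V adj A v0 (st u)"
    "\<And>u c. c \<subseteq> {..<rank d} \<Longrightarrow> st u (set_word c) = st u [] \<longleftrightarrow> c \<in> trivial_sets d u"
    "\<And>u. st u short_loop = st u []" "\<And>u. card (st u ` walks) \<le> order_bound d"
    by metis
  define \<Gamma> where "\<Gamma> u = regular_cover.cover adj v0 (st u)" for u
  have \<Gamma>: "\<Gamma> u \<in> cubic_5_arc_transitive_graphs n" for u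
  proof -
    interpret regular_cover V adj A v0 "st u" by (rule st)
    show ?thesis
      unfolding cubic_5_arc_transitive_graphs_def \<Gamma>_def
      using cover_pair_graph cover_connected cover_cubic cover_5_arc_transitive st(4)[of u] n by simp
  qed
  define cls where "cls u = iso_rel n `` {\<Gamma> u}" for u
  have "card (trivial_sets d ` {v \<in> tuples d. cls v = cls u}) \<le> order_bound d ^ (3 * length short_loop + 1)" for u
  proof -
    interpret C: regular_cover V adj A v0 "st u" by (rule st)
    \<comment> \<open>The closed arc has the same length in every cover, so the exponent does not
      grow with \<open>d\<close>.\<close>
    obtain P where P: "s_arc (with_proj (\<Gamma> u)) (length short_loop) P" "P ! 0 = P ! length short_loop"
      using C.closed_s_arc[of short_loop] short_loop(1,2) st(3) unfolding loop_def \<Gamma>_def by blast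
    have "\<exists>f. vert_iso (\<Gamma> v) (\<Gamma> u) f" if "cls v = cls u" for v
    proof -
      have "(\<Gamma> u, \<Gamma> u) \<in> iso_rel n" unfolding iso_rel_iff[OF \<Gamma>] using \<Gamma> vert_iso_id by blast
      then have "(\<Gamma> v, \<Gamma> u) \<in> iso_rel n" using that unfolding cls_def by blast
      then show ?thesis unfolding iso_rel_iff[OF \<Gamma>] by blast
    qed
    then obtain f where f: "\<And>v. cls v = cls u \<Longrightarrow> vert_iso (\<Gamma> v) (\<Gamma> u) (f v)" by metis
    have "card (trivial_sets d ` {v \<in> tuples d. cls v = cls u}) \<le> card (pverts (\<Gamma> u)) ^ (3 * length short_loop + 1)"
    proof (rule card_covers_of_graph_le[OF _ _ P short_loop(3) st(1)])
      show "cubic_graph (\<Gamma> u)" "s_arc_transitive 1 (with_proj (\<Gamma> u))"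
        unfolding \<Gamma>_def by (rule C.cover_cubic_graph, rule C.cover_1_arc_transitive)
      show "vert_iso (regular_cover.cover adj v0 (st v)) (\<Gamma> u) (f v)" if "v \<in> {v \<in> tuples d. cls v = cls u}" for v
        using f[of v] that unfolding \<Gamma>_def by simp
      fix v v'
      assume "\<And>xs ys. walk adj v0 xs \<Longrightarrow> walk adj v0 ys \<Longrightarrow> st v xs = st v ys \<longleftrightarrow> st v' xs = st v' ys"
      then have "st v (set_word c) = st v [] \<longleftrightarrow> st v' (set_word c) = st v' []" for c
        using loop_set_word[of c] unfolding loop_def by simp
      then have "c \<in> trivial_sets d v \<longleftrightarrow> c \<in> trivial_sets d v'" if "c \<subseteq> {..<rank d}" for c
        using st(2)[OF that] by blast
      moreover have "c \<subseteq> {..<rank d}" if "c \<in> trivial_sets d w" for c w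
        using that by (simp add: trivial_sets_def)
      ultimately show "trivial_sets d v = trivial_sets d v'" by blast
    qed
    also have "\<dots> \<le> order_bound d ^ (3 * length short_loop + 1)"
      using st(4)[of u] by (intro power_mono) (simp_all add: \<Gamma>_def)
    finally show ?thesis .
  qed
  then have "card (trivial_sets d ` tuples d) \<le> card (cls ` tuples d) * order_bound d ^ (3 * length short_loop + 1)"
    by (intro card_image_le_fibres finite_tuples)
  moreover have "card (cls ` tuples d) \<le> card (isomorphism_classes (cubic_5_arc_transitive_graphs n))"
    using \<Gamma> by (intro card_mono finite_isomorphism_classes) (auto simp: isomorphism_classes_eq cls_def)
  ultimately show ?thesis
    using card_trivial_sets_image[of d] by (meson le_trans mult_le_mono1)
qed

section \<open>The Tutte 8-cage\<close>

text \<open>The cage in LCF notation is \<open>[-13, -9, 7, -7, 9, 13]\<^sup>5\<close>; the offsets below are taken modulo 30.\<close>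

definition cage_nbrs :: "nat \<Rightarrow> nat list" where
  "cage_nbrs i = [(i + 1) mod 30, (i + 29) mod 30, (i + [17, 21, 7, 23, 9, 13] ! (i mod 6)) mod 30]"

definition cage_adj :: "nat \<Rightarrow> nat \<Rightarrow> bool" where
  "cage_adj i j \<longleftrightarrow> i < 30 \<and> j \<in> set (cage_nbrs i)"

text \<open>Fixing all numbers from 30 on makes this a finite set of functions on the whole
  type.\<close>

definition cage_aut :: "(nat \<Rightarrow> nat) set" where
  "cage_aut = {a. a permutes {..<30} \<and> (\<forall>u v. cage_adj (a u) (a v) \<longleftrightarrow> cage_adj u v)}"

definition perm_of_list :: "nat list \<Rightarrow> nat \<Rightarrow> nat" where
  "perm_of_list l i = (if i < 30 then l ! i else i)"

definition aut_list :: "nat list \<Rightarrow> bool" where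
  "aut_list l \<longleftrightarrow> sort l = [0..<30] \<and>
    list_all (\<lambda>i. set (map (nth l) (cage_nbrs i)) = set (cage_nbrs (l ! i))) [0..<30]"

text \<open>Rotation by 24, and automorphisms mapping \<open>1, \<dots>, 5\<close> to \<open>0\<close>.\<close>

definition cage_moves :: "nat list list" where
  "cage_moves = [
    [24, 25, 26, 27, 28, 29, 0, 1, 2, 3, 4, 5, 6, 7, 8, 9, 10, 11, 12, 13, 14, 15, 16, 17, 18, 19, 20, 21, 22, 23],
    [1, 0, 17, 16, 25, 24, 11, 10, 19, 18, 5, 4, 3, 26, 27, 20, 21, 22, 23, 6, 7, 28, 29, 12, 13, 14, 15, 8, 9, 2],
    [2, 1, 0, 17, 16, 25, 24, 11, 12, 29, 28, 7, 8, 15, 14, 13, 4, 3, 26, 27, 20, 21, 22, 23, 6, 5, 18, 19, 10, 9],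
    [9, 2, 1, 0, 17, 16, 25, 24, 23, 22, 21, 20, 19, 18, 5, 6, 7, 8, 15, 14, 13, 4, 3, 26, 27, 28, 29, 12, 11, 10],
    [8, 9, 2, 1, 0, 17, 18, 5, 4, 3, 26, 27, 28, 29, 12, 13, 14, 15, 16, 25, 24, 11, 10, 19, 20, 21, 22, 23, 6, 7],
    [7, 8, 9, 2, 1, 0, 17, 18, 19, 10, 11, 24, 23, 22, 21, 20, 27, 28, 29, 12, 13, 14, 15, 16, 25, 26, 3, 4, 5, 6]]"

text \<open>For every \<open>k < 5\<close>, automorphisms fixing \<open>0, \<dots>, k\<close> and moving any admissible continuation of this
  walk to \<open>k + 1\<close>.\<close>

definition cage_stabilizers :: "nat list list" where
  "cage_stabilizers = [
    [0, 1, 2, 3, 4, 5, 6, 7, 8, 9, 10, 11, 12, 13, 14, 15, 16, 17, 18, 19, 20, 21, 22, 23, 24, 25, 26, 27, 28, 29],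
    [0, 17, 16, 25, 24, 11, 10, 9, 8, 15, 14, 21, 22, 23, 6, 7, 28, 29, 12, 13, 4, 5, 18, 19, 20, 27, 26, 3, 2, 1],
    [0, 17, 16, 25, 24, 23, 6, 7, 8, 15, 14, 13, 12, 11, 10, 9, 2, 1, 22, 21, 20, 19, 18, 5, 4, 3, 26, 27, 28, 29],
    [0, 1, 22, 21, 20, 19, 10, 11, 24, 23, 6, 7, 28, 27, 26, 25, 16, 17, 18, 5, 4, 3, 2, 9, 8, 15, 14, 13, 12, 29],
    [0, 1, 2, 9, 8, 7, 6, 5, 4, 3, 26, 25, 16, 15, 14, 13, 12, 29, 28, 27, 20, 21, 22, 23, 24, 11, 10, 19, 18, 17],
    [0, 1, 2, 3, 26, 25, 24, 11, 10, 9, 8, 7, 28, 27, 20, 19, 18, 17, 16, 15, 14, 21, 22, 23, 6, 5, 4, 13, 12, 29],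
    [0, 1, 2, 3, 4, 13, 14, 15, 8, 9, 10, 19, 18, 5, 6, 7, 28, 29, 12, 11, 24, 23, 22, 21, 20, 27, 26, 25, 16, 17]]"

section \<open>Checking the tabulated automorphisms by evaluation\<close>

lemma cage_nbrs_check:
  "list_all (\<lambda>i. distinct (cage_nbrs i) \<and> list_all (\<lambda>j. j < 30 \<and> j \<noteq> i \<and> i \<in> set (cage_nbrs j)) (cage_nbrs i)) [0..<30]"
  by code_simp

lemma aut_list_cage_moves: "list_all aut_list cage_moves"
  by code_simp

lemma aut_list_cage_stabilizers: "list_all aut_list cage_stabilizers"
  by code_simp

lemma cage_moves_check:
  "list_all (\<lambda>v. cage_moves ! 0 ! v = v - 6) [6..<30]" "list_all (\<lambda>v. cage_moves ! v ! v = 0) [1..<6]"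
  by code_simp+

lemma cage_stabilizers_check:
  "list_all (\<lambda>k. list_all (\<lambda>y. (k > 0 \<and> y = k - 1) \<or>
    list_ex (\<lambda>l. take (Suc k) l = [0..<Suc k] \<and> l ! y = Suc k) cage_stabilizers) (cage_nbrs k)) [0..<5]"
  by code_simp

lemma cage_nbrs:
  assumes "i < 30"
  shows "distinct (cage_nbrs i)" "j \<in> set (cage_nbrs i) \<Longrightarrow> j < 30 \<and> j \<noteq> i \<and> i \<in> set (cage_nbrs j)"
proof -
  have "i \<in> set [0..<30]" unfolding set_upt using assms by simp
  then have "distinct (cage_nbrs i) \<and> (\<forall>j \<in> set (cage_nbrs i). j < 30 \<and> j \<noteq> i \<and> i \<in> set (cage_nbrs j))"
    using cage_nbrs_check unfolding list_all_iff by (rule bspec[rotated])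
  then show "distinct (cage_nbrs i)" "j \<in> set (cage_nbrs i) \<Longrightarrow> j < 30 \<and> j \<noteq> i \<and> i \<in> set (cage_nbrs j)"
    by blast+
qed

lemma cage_adjD:
  assumes "cage_adj i j"
  shows "i < 30" "j < 30" "i \<noteq> j" "cage_adj j i"
  using assms cage_nbrs(2)[of i j] unfolding cage_adj_def by blast+

lemma card_cage_nbrs:
  assumes "i < 30"
  shows "card {j. cage_adj i j} = 3"
proof -
  have "{j. cage_adj i j} = set (cage_nbrs i)" using assms by (simp add: cage_adj_def)
  also have "card \<dots> = length (cage_nbrs i)" by (rule distinct_card[OF cage_nbrs(1)[OF assms]])
  finally show ?thesis by (simp add: cage_nbrs_def)
qed

lemma perm_of_aut_list:
  assumes "aut_list l"
  shows "perm_of_list l \<in> cage_aut"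
proof -
  let ?p = "perm_of_list l"
  have l: "set l = {..<30}" "distinct l" "length l = 30"
  proof -
    have "set (sort l) = {0..<30}" "distinct (sort l)" "length (sort l) = 30"
      using assms unfolding aut_list_def by (simp_all del: set_sort distinct_sort length_sort upt_conv_Cons)
    then show "set l = {..<30}" "distinct l" "length l = 30" by (simp_all add: lessThan_atLeast0)
  qed
  have "bij_betw ?p {..<30} {..<30}"
    using bij_betw_nth[OF l(2) l(3)[symmetric, THEN arg_cong[of _ _ lessThan]] l(1)[symmetric]]
    by (subst bij_betw_cong[of _ _ "nth l"]) (auto simp: perm_of_list_def)
  then have perm: "?p permutes {..<30}"
    by (rule bij_imp_permutes) (simp add: perm_of_list_def)
  have "cage_adj (?p u) (?p v) \<longleftrightarrow> cage_adj u v" for u v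
  proof (cases "u < 30")
    case True
    have "?p ` set (cage_nbrs u) = set (map (nth l) (cage_nbrs u))"
      using cage_nbrs(2)[OF True] unfolding set_map by (intro image_cong) (auto simp: perm_of_list_def)
    also have "\<dots> = set (cage_nbrs (?p u))"
    proof -
      have "u \<in> set [0..<30]" unfolding set_upt using True by simp
      then have "set (map (nth l) (cage_nbrs u)) = set (cage_nbrs (l ! u))"
        using assms unfolding aut_list_def list_all_iff by blast
      then show ?thesis using True by (simp add: perm_of_list_def)
    qed
    finally have "?p v \<in> set (cage_nbrs (?p u)) \<longleftrightarrow> v \<in> set (cage_nbrs u)"
      using inj_image_mem_iff[OF permutes_inj[OF perm], of v "set (cage_nbrs u)"] by simp
    moreover have "?p u < 30" using permutes_in_image[OF perm, of u] True by simp
    ultimately show ?thesis using True by (simp add: cage_adj_def)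
  qed (simp add: cage_adj_def perm_of_list_def)
  then show ?thesis using perm by (simp add: cage_aut_def)
qed

lemma cage_aut_group:
  "id \<in> cage_aut" "a \<in> cage_aut \<Longrightarrow> b \<in> cage_aut \<Longrightarrow> a \<circ> b \<in> cage_aut"
  "a \<in> cage_aut \<Longrightarrow> \<exists>b \<in> cage_aut. b \<circ> a = id \<and> a \<circ> b = id"
proof -
  show "id \<in> cage_aut" by (simp add: cage_aut_def permutes_id)
  show "a \<in> cage_aut \<Longrightarrow> b \<in> cage_aut \<Longrightarrow> a \<circ> b \<in> cage_aut"
    by (simp add: cage_aut_def permutes_compose)
  assume a: "a \<in> cage_aut"
  then have p: "a permutes {..<30}" by (simp add: cage_aut_def)
  have inv: "a (inv a v) = v" for v using permutes_inverses[OF p] by simp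
  have "inv a \<in> cage_aut"
  proof -
    have "cage_adj (inv a u) (inv a v) \<longleftrightarrow> cage_adj u v" for u v
      using a inv[of u] inv[of v] unfolding cage_aut_def mem_Collect_eq by metis
    then show ?thesis using permutes_inv[OF p] by (simp add: cage_aut_def)
  qed
  then show "\<exists>b \<in> cage_aut. b \<circ> a = id \<and> a \<circ> b = id"
    using permutes_inv_o[OF p] by blast
qed

lemma finite_cage_aut: "finite cage_aut"
  by (rule finite_subset[OF _ finite_permutations[of "{..<30::nat}"]]) (auto simp: cage_aut_def)

text \<open>The rotation lowers \<open>v\<close> by 6 until it is below 6, where the table takes
  over.\<close>

lemma cage_vertex_to_0: "v < 30 \<Longrightarrow> \<exists>a \<in> cage_aut. a v = 0"
proof (induction v rule: less_induct)
  case (less v)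
  have moves: "perm_of_list (cage_moves ! i) \<in> cage_aut" if "i < 6" for i
  proof -
    have "length cage_moves = 6" by (simp add: cage_moves_def)
    then show ?thesis using aut_list_cage_moves that perm_of_aut_list unfolding list_all_length by simp
  qed
  consider "v = 0" | "0 < v" "v < 6" | "6 \<le> v" by linarith
  then show ?case
  proof cases
    case 1
    then show ?thesis using cage_aut_group(1) by (intro bexI[of _ id]) auto
  next
    case 2
    then have "v \<in> set [1..<6]" unfolding set_upt by simp
    then have "cage_moves ! v ! v = 0" using cage_moves_check(2) unfolding list_all_iff by blast
    then have "perm_of_list (cage_moves ! v) v = 0" using 2 by (simp add: perm_of_list_def)
    then show ?thesis using moves[of v] 2 by blast
  next
    case 3
    then have "v \<in> set [6..<30]" unfolding set_upt using less.prems by simp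
    then have "cage_moves ! 0 ! v = v - 6" using cage_moves_check(1) unfolding list_all_iff by blast
    then have "perm_of_list (cage_moves ! 0) v = v - 6" using less.prems by (simp add: perm_of_list_def)
    moreover have "\<exists>a \<in> cage_aut. a (v - 6) = 0" by (rule less.IH) (use less.prems 3 in auto)
    then obtain a where "a \<in> cage_aut" "a (v - 6) = 0" by blast
    ultimately show ?thesis
      using cage_aut_group(2)[OF _ moves[of 0], of a] by (intro bexI[of _ "a \<circ> perm_of_list (cage_moves ! 0)"]) auto
  qed
qed

lemma reduced_snocD:
  assumes "reduced (p @ [x])"
  shows "reduced p" "length p > 1 \<Longrightarrow> x \<noteq> p ! (length p - 2)"
proof -
  have p: "(p @ [x]) ! i \<noteq> (p @ [x]) ! Suc (Suc i)" if "Suc (Suc i) < Suc (length p)" for i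
    using assms that by (simp add: reduced_def)
  show "reduced p" unfolding reduced_def
  proof (intro allI impI)
    fix i assume "Suc (Suc i) < length p"
    then show "p ! i \<noteq> p ! Suc (Suc i)" using p[of i] by (simp add: nth_append)
  qed
  assume "length p > 1"
  then have "Suc (Suc (length p - 2)) = length p" by simp
  then show "x \<noteq> p ! (length p - 2)" using p[of "length p - 2"] \<open>length p > 1\<close> by (simp add: nth_append)
qed

text \<open>Once the initial part lies on \<open>0, \<dots>, k\<close>, an automorphism fixing these
  vertices moves the image of the next one to \<open>k + 1\<close>.\<close>

lemma cage_walk_to_standard:
  assumes "u < 30" "walk cage_adj u xs" "length xs \<le> 5" "reduced (u # xs)"
  shows "\<exists>a \<in> cage_aut. map a (u # xs) = [0..<Suc (length xs)]"
  using assms(2-)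
proof (induction xs rule: rev_induct)
  case Nil
  then show ?case using cage_vertex_to_0[OF assms(1)] by auto
next
  case (snoc x xs)
  let ?k = "length xs"
  have red: "reduced (u # xs)" and x: "?k > 0 \<Longrightarrow> x \<noteq> (u # xs) ! (?k - 1)"
    using reduced_snocD[of "u # xs" x] snoc.prems(3) by auto
  have w: "walk cage_adj u xs" "cage_adj (fin_vert u xs) x" using snoc.prems(1) by auto
  obtain a where a: "a \<in> cage_aut" "map a (u # xs) = [0..<Suc ?k]"
    using snoc.IH w(1) red snoc.prems(2) by auto
  have nth: "a ((u # xs) ! i) = i" if "i \<le> ?k" for i
    using arg_cong[OF a(2), of "\<lambda>l. l ! i"] that by (simp del: upt_Suc list.map)
  have fin: "a (fin_vert u xs) = ?k"
    using nth[of ?k] fin_vert_take[of ?k xs u] by simp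
  have inj: "inj a" using a(1) permutes_inj by (auto simp: cage_aut_def)
  have "cage_adj (a (fin_vert u xs)) (a x)" using w(2) a(1) by (simp add: cage_aut_def)
  then have "cage_adj ?k (a x)" unfolding fin .
  then have "a x \<in> set (cage_nbrs ?k)" by (simp add: cage_adj_def)
  \<comment> \<open>Reducedness excludes the one neighbour, \<open>k - 1\<close>, that the
    stabilizer keeps fixed.\<close>
  moreover have "\<not> (?k > 0 \<and> a x = ?k - 1)"
    using nth[of "?k - 1"] x inj_eq[OF inj, of x "(u # xs) ! (?k - 1)"] by auto
  moreover have "?k \<in> set [0..<5]" unfolding set_upt using snoc.prems(2) by simp
  ultimately obtain l where l: "l \<in> set cage_stabilizers" "take (Suc ?k) l = [0..<Suc ?k]" "l ! a x = Suc ?k"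
    using cage_stabilizers_check unfolding list_all_iff list_ex_iff by blast
  have b: "perm_of_list l \<in> cage_aut"
    using aut_list_cage_stabilizers l(1) perm_of_aut_list unfolding list_all_iff by blast
  have "perm_of_list l i = i" if "i \<le> ?k" for i
    using arg_cong[OF l(2), of "\<lambda>l. l ! i"] that snoc.prems(2) by (simp add: perm_of_list_def del: upt_Suc)
  then have "map (perm_of_list l) [0..<Suc ?k] = [0..<Suc ?k]"
    by (intro map_idI) auto
  then have "map (perm_of_list l \<circ> a) (u # xs) = [0..<Suc ?k]"
    unfolding map_map[symmetric] a(2) .
  moreover have "a x < 30" using cage_adjD(2)[OF \<open>cage_adj ?k (a x)\<close>] .
  then have "(perm_of_list l \<circ> a) x = Suc ?k" using l(3) by (simp add: perm_of_list_def)
  ultimately have "map (perm_of_list l \<circ> a) (u # xs @ [x]) = [0..<Suc (length (xs @ [x]))]"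
    by simp
  then show ?case using cage_aut_group(2)[OF b a(1)] by blast
qed

lemma base_graph_cage: "base_graph {..<30} cage_adj cage_aut 0"
proof
  fix u v xs ys
  assume u: "u \<in> {..<30}" "walk cage_adj u xs" "length xs = 5" "reduced (u # xs)"
    and v: "v \<in> {..<30}" "walk cage_adj v ys" "length ys = 5" "reduced (v # ys)"
  have "\<exists>a \<in> cage_aut. map a (u # xs) = [0..<Suc (length xs)]" "\<exists>b \<in> cage_aut. map b (v # ys) = [0..<Suc (length ys)]"
    by (rule cage_walk_to_standard; use u v in simp)+
  then obtain a b where ab: "a \<in> cage_aut" "map a (u # xs) = [0..<Suc 5]" "b \<in> cage_aut" "map b (v # ys) = [0..<Suc 5]"
    unfolding u(3) v(3) by blast
  \<comment> \<open>Both walks are carried to the standard one; undoing the second motion takes the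
    first walk to the second.\<close>
  obtain b' where b': "b' \<in> cage_aut" "b' \<circ> b = id" using cage_aut_group(3)[OF ab(3)] by blast
  have "map (b' \<circ> a) (u # xs) = map (b' \<circ> b) (v # ys)"
    unfolding map_map[symmetric] ab(2,4) ..
  then have "(b' \<circ> a) u = v" "map (b' \<circ> a) xs = ys" unfolding b'(2) by simp_all
  then show "\<exists>a \<in> cage_aut. a u = v \<and> map a xs = ys" using cage_aut_group(2)[OF b'(1) ab(1)] by blast
next
  fix v :: nat assume "v \<in> {..<30}"
  then have "v < 30" by simp
  then obtain a where a: "a \<in> cage_aut" "a v = 0" using cage_vertex_to_0 by blast
  obtain b where "b \<in> cage_aut" "b \<circ> a = id" using cage_aut_group(3)[OF a(1)] by blast
  then show "\<exists>a \<in> cage_aut. a 0 = v" using a(2) by (metis comp_apply id_apply)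
next
  show "finite cage_aut" by (rule finite_cage_aut)
  show "id \<in> cage_aut" "a \<in> cage_aut \<Longrightarrow> b \<in> cage_aut \<Longrightarrow> a \<circ> b \<in> cage_aut"
    "a \<in> cage_aut \<Longrightarrow> \<exists>b \<in> cage_aut. b \<circ> a = id \<and> a \<circ> b = id" for a b
    by (fact cage_aut_group)+
  show "cage_adj (a u) (a v) \<longleftrightarrow> cage_adj u v" if "a \<in> cage_aut" for a u v
    using that unfolding cage_aut_def by blast
  show "cage_adj v u" "u \<in> {..<30}" if "cage_adj u v" for u v
    using cage_adjD[OF that] by simp_all
  show "\<not> cage_adj v v" for v using cage_adjD(3)[of v v] by blast
  show "card {w. cage_adj v w} = 3" if "v \<in> {..<30}" for v using card_cage_nbrs[of v] that by simp
qed simp_all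

text \<open>The three edges carrying nontrivial voltages lie on one each of the 8-cycles \<open>X\<close>, \<open>Y\<close>, \<open>Z\<close>
  through the base point that are used in the interpretation below.\<close>

definition cage_voltage :: "nat \<Rightarrow> nat \<Rightarrow> bit fps hall" where
  "cage_voltage u v =
    (if (u, v) = (12, 29) then Hall 1 1 0 0 else if (u, v) = (29, 12) then Hall 1 (-1) 0 0
     else if (u, v) = (28, 29) then Hall 1 0 1 0 else if (u, v) = (29, 28) then Hall 1 0 (-1) 0
     else if (u, v) = (4, 5) then Hall (1 + fps_X) 0 0 0
     else if (u, v) = (5, 4) then Hall (inverse (1 + fps_X)) 0 0 0 else 1)"

text \<open>In recursive form the condition can be verified by simplification on a walk of 256
  steps.\<close>

lemma reduced_rec:
  "reduced [x, y]" "reduced (x # y # z # p) \<longleftrightarrow> x \<noteq> z \<and> reduced (y # z # p)"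
proof -
  show "reduced [x, y]" by (simp add: reduced_def)
  have *: "(\<forall>i. P i) \<longleftrightarrow> P 0 \<and> (\<forall>i. P (Suc i))" for P :: "nat \<Rightarrow> bool" by (metis not0_implies_Suc)
  show "reduced (x # y # z # p) \<longleftrightarrow> x \<noteq> z \<and> reduced (y # z # p)"
    unfolding reduced_def by (subst *) simp
qed

lemma cage_voltage_inverse: "cage_voltage u v * cage_voltage v u = 1"
proof -
  have inv: "(1 + fps_X) * inverse (1 + fps_X :: bit fps) = 1"
    by (rule inverse_mult_eq_1') simp
  then have inv': "inverse (1 + fps_X :: bit fps) * (1 + fps_X) = 1"
    by (simp only: mult.commute)
  consider "(u, v) = (12, 29)" | "(u, v) = (29, 12)" | "(u, v) = (28, 29)" | "(u, v) = (29, 28)"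
    | "(u, v) = (4, 5)" | "(u, v) = (5, 4)"
    | "(u, v) \<notin> {(12, 29), (29, 12), (28, 29), (29, 28), (4, 5), (5, 4)}"
      "(v, u) \<notin> {(12, 29), (29, 12), (28, 29), (29, 28), (4, 5), (5, 4)}" by blast
  then show ?thesis
  proof cases
    case 7
    then have "cage_voltage u v = 1" "cage_voltage v u = 1"
      unfolding cage_voltage_def insert_iff empty_iff by (simp_all only: if_False de_Morgan_disj)
    then show ?thesis by simp
  qed (simp_all add: cage_voltage_def hall_simps inv inv')
qed

lemma cage_walks:
  "walk cage_adj 0 [1, 2, 3, 4, 13, 12, 29, 0]" "walk cage_adj 0 [1, 2, 3, 4, 5, 18, 17, 0]"
  "walk cage_adj 0 [17, 18, 19, 20, 27, 28, 29, 0]"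
  by code_simp+

lemma cage_volumes:
  "vol cage_voltage 0 [1, 2, 3, 4, 13, 12, 29, 0] = Hall 1 1 0 0"
  "vol cage_voltage 0 [1, 2, 3, 4, 5, 18, 17, 0] = Hall (1 + fps_X) 0 0 0"
  "vol cage_voltage 0 [17, 18, 19, 20, 27, 28, 29, 0] = Hall 1 0 1 0"
  unfolding cage_voltage_def by simp_all

lemma cage_reduced_word:
  defines "X \<equiv> [1, 2, 3, 4, 13, 12, 29, 0]" and "Y \<equiv> [1, 2, 3, 4, 5, 18, 17, 0 :: nat]" and "Z \<equiv> [17, 18, 19, 20, 27, 28, 29, 0]"
  shows "reduced (0 # comm_walk 0 (comm_walk 0 X Y) (comm_walk 0 (back_walk 0 Y) Z)
      @ comm_walk 0 (comm_walk 0 X Y) (comm_walk 0 (back_walk 0 Y) Z))"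
  unfolding X_def Y_def Z_def comm_walk_def back_walk.simps append.simps
  by (simp only: reduced_rec) simp

interpretation cage: growth_graph "{..<30}" cage_adj cage_aut 0 cage_voltage
  "[1, 2, 3, 4, 13, 12, 29, 0]" "[1, 2, 3, 4, 5, 18, 17, 0]" "[17, 18, 19, 20, 27, 28, 29, 0]"
  by (intro growth_graph.intro voltage_graph.intro base_graph_cage voltage_graph_axioms.intro
      growth_graph_axioms.intro cage_voltage_inverse cage_walks cage_volumes cage_reduced_word) simp_all

section \<open>The growth rate\<close>

text \<open>If \<open>n\<close> lies between \<open>2 ^ (C * d)\<close> and
  \<open>2 ^ (C * (d + 1))\<close>, then \<open>ln n\<close> is of order \<open>d\<close>, while the
  hypothesis forces the logarithm of the count to be at least of order
  \<open>d\<^sup>2\<close>.\<close>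

lemma quasipolynomial_growth:
  fixes \<kappa> :: "nat \<Rightarrow> nat" and C E :: nat
  assumes C: "C \<ge> 1"
    and \<kappa>: "\<And>d n. d \<ge> 1 \<Longrightarrow> 2 ^ (C * d) \<le> n \<Longrightarrow> 2 ^ (d * d) \<le> \<kappa> n * 2 ^ (E * d)"
  shows "\<exists>a b :: real. a > 0 \<and> b > 0 \<and>
    (\<forall>n :: nat. n \<ge> 1 \<longrightarrow> real (\<kappa> n) \<ge> real n powr (a * ln (real n)) - b)"
proof -
  \<comment> \<open>For \<open>d > 2 * E\<close> the count is at least 2 to the power
    \<open>d * d / 2\<close>, and \<open>ln n\<close> is at most \<open>2 * C * d * ln 2\<close>;
    this \<open>a\<close> makes the two estimates meet.\<close>
  define a where "a = 1 / (8 * real C ^ 2 * ln 2)"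
  \<comment> \<open>This bounds \<open>exp (a * (ln n)\<^sup>2)\<close> for the \<open>n\<close>
    with \<open>d \<le> 2 * E\<close>, so that the claimed lower bound is not positive
    there.\<close>
  define b where "b = exp (a * (real C * (2 * real E + 1) * ln 2) ^ 2)"
  have a: "a > 0" using C by (simp add: a_def)
  have b: "b > 0" by (simp add: b_def)
  have "real n powr (a * ln (real n)) - b \<le> real (\<kappa> n)" if n: "n \<ge> 1" for n
  proof -
    have "2 ^ 1 \<le> (2 :: nat) ^ C" using C by (intro power_increasing) auto
    then obtain d where "(2 ^ C) ^ d \<le> n" "n < (2 ^ C) ^ (d + 1)"
      using ex_power_ivl1[of "2 ^ C" n] n by auto
    then have d: "2 ^ (C * d) \<le> n" "n < 2 ^ (C * (d + 1))" by (simp_all only: power_mult)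
    have "real n \<le> 2 ^ (C * (d + 1))" using d(2) by (metis less_imp_le of_nat_le_iff of_nat_numeral of_nat_power)
    then have "ln (real n) \<le> ln (2 ^ (C * (d + 1)))" using n by simp
    then have ln_n: "ln (real n) \<le> real C * (real d + 1) * ln 2" by (simp add: ln_realpow algebra_simps)
    have ln_0: "ln (real n) \<ge> 0" using n by simp
    have powr: "real n powr (a * ln (real n)) = exp (a * ln (real n) ^ 2)"
      using n by (simp add: powr_def power2_eq_square)
    show ?thesis
    proof (cases "d \<le> 2 * E")
      case True
      then have "real d + 1 \<le> 2 * real E + 1" by simp
      then have "real C * (real d + 1) * ln 2 \<le> real C * (2 * real E + 1) * ln 2"
        by (intro mult_right_mono mult_left_mono) auto
      then have "ln (real n) ^ 2 \<le> (real C * (2 * real E + 1) * ln 2) ^ 2"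
        using ln_n ln_0 by (intro power_mono) linarith+
      then have "real n powr (a * ln (real n)) \<le> b"
        unfolding powr b_def using a by simp
      then show ?thesis by linarith
    next
      case False
      then have d1: "d \<ge> 1" and dE: "2 * real E \<le> real d" by auto
      have "real (2 ^ (d * d)) \<le> real (\<kappa> n * 2 ^ (E * d))"
        using \<kappa>[OF d1 d(1)] of_nat_le_iff by blast
      then have "2 powr (real d * real d) \<le> real (\<kappa> n) * 2 powr (real E * real d)"
        by (simp add: powr_realpow[symmetric])
      then have "2 powr (real d * real d - real E * real d) \<le> real (\<kappa> n)"
        by (simp add: powr_diff divide_simps)
      moreover have "a * ln (real n) ^ 2 \<le> (real d * real d - real E * real d) * ln 2"
      proof -
        have "real C * (real d + 1) * ln 2 \<le> real C * (2 * real d) * ln 2"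
          using d1 by (intro mult_right_mono mult_left_mono) auto
        then have "ln (real n) ^ 2 \<le> (real C * (2 * real d) * ln 2) ^ 2"
          using ln_n ln_0 by (intro power_mono) linarith+
        then have "a * ln (real n) ^ 2 \<le> a * (real C * (2 * real d) * ln 2) ^ 2"
          using a by (intro mult_left_mono) auto
        also have "\<dots> = real d * real d / 2 * ln 2"
          using C by (simp add: a_def power2_eq_square field_simps)
        also have "\<dots> \<le> (real d * real d - real E * real d) * ln 2"
          using mult_right_mono[OF dE, of "real d"] by (intro mult_right_mono) auto
        finally show ?thesis .
      qed
      then have "real n powr (a * ln (real n)) \<le> 2 powr (real d * real d - real E * real d)"
        unfolding powr by (simp add: powr_def)
      ultimately show ?thesis using b by linarith
    qed
  qed
  then show ?thesis using a b by blast
qed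

theorem theorem1p4:
  shows "\<exists>a b :: real. a > 0 \<and> b > 0 \<and>
    (\<forall>n :: nat. n \<ge> 1 \<longrightarrow>
      real (card (isomorphism_classes (cubic_5_arc_transitive_graphs n)))
        \<ge> real n powr (a * ln (real n)) - b)"
proof -
  define c where "c = card cage_aut"
  \<comment> \<open>The 5 pays for \<open>30 \<le> 2 ^ 5\<close>, the rest for the exponent
    \<open>8 * c * c * d + 8 * c\<close>, whose constant term is absorbed since
    \<open>d \<ge> 1\<close>.\<close>
  define C where "C = 5 + 8 * c + 8 * c * c"
  \<comment> \<open>The power of the order that bounds the covers per class is constant: the loss is
    exponential in \<open>d\<close>, the gain in \<open>d\<^sup>2\<close>.\<close>
  define e where "e = 3 * length cage.short_loop + 1"
  have bound: "cage.order_bound d \<le> 2 ^ (C * d)" if d: "d \<ge> 1" for d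
  proof -
    have "4 * (cage.rank d + 2) * c = 8 * c * c * d + 8 * c"
      by (simp add: cage.rank_def c_def algebra_simps)
    also have "\<dots> \<le> (8 * c + 8 * c * c) * d" using d by (simp add: algebra_simps)
    finally have "(2 :: nat) ^ (4 * (cage.rank d + 2) * c) \<le> 2 ^ ((8 * c + 8 * c * c) * d)"
      by (intro power_increasing) auto
    moreover have "(30 :: nat) \<le> 2 ^ (5 * d)"
      using power_increasing[of 5 "5 * d" "2 :: nat"] d by simp
    ultimately have "30 * 2 ^ (4 * (cage.rank d + 2) * c) \<le> (2 :: nat) ^ (5 * d) * 2 ^ ((8 * c + 8 * c * c) * d)"
      by (intro mult_mono) auto
    also have "\<dots> = 2 ^ (C * d)" by (simp add: C_def algebra_simps flip: power_add)
    finally show ?thesis by (simp add: c_def power_mult)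
  qed
  show ?thesis
  proof (rule quasipolynomial_growth[of C _ "C * e"])
    show "1 \<le> C" by (simp add: C_def)
    fix d n :: nat
    assume d: "d \<ge> 1" "2 ^ (C * d) \<le> n"
    let ?k = "card (isomorphism_classes (cubic_5_arc_transitive_graphs n))"
    \<comment> \<open>The group is nonempty, so the exponent \<open>c * d * d\<close> may be lowered
      to \<open>d * d\<close>.\<close>
    have "1 * (d * d) \<le> c * (d * d)"
      using cage.card_A_pos by (intro mult_right_mono) (auto simp: c_def Suc_leI)
    then have "(2 :: nat) ^ (d * d) \<le> 2 ^ (c * d * d)"
      by (intro power_increasing) (auto simp: mult.assoc)
    also have "\<dots> \<le> ?k * cage.order_bound d ^ e"
      unfolding c_def e_def
      using order_trans[OF bound[OF d(1)] d(2)] by (rule cage.card_isomorphism_classes_ge)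
    also have "\<dots> \<le> ?k * (2 ^ (C * d)) ^ e"
      using bound[OF d(1)] by (intro mult_left_mono power_mono) auto
    also have "\<dots> = ?k * 2 ^ (C * e * d)" by (simp add: ac_simps flip: power_mult)
    finally show "2 ^ (d * d) \<le> ?k * 2 ^ (C * e * d)" .
  qed
qed

end
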